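(* Let $z_0\in(-1,1)$, $s>0$ real, $\mu\ge1$ an integer, $g\in C^\infty[-1,1]$, $f(x)=|x-z_0|^{s}\ln^{\mu}|x-z_0|\,g(x)$, and let $\lambda>-\frac12$, $\lambda\neq0$. Then the Gegenbauer coefficients $a_n(\lambda)$ and the Chebyshev coefficients $c_n$ of $f$ satisfy, as $n\to\infty$, $$|a_n(\lambda)|=O\big(\ln^{\mu}(n)\,n^{-\lambda-s}\big),\qquad |c_n|=O\big(\ln^{\mu}(n)\,n^{-1-s}\big).$$
   Context: $C_n^{(\lambda)}$ is the Gegenbauer polynomial of degree $n$ and $T_n$ the Chebyshev polynomial of the first kind. $a_n(\lambda)=\frac1{h_n}\int_{-1}^1(1-x^2)^{\lambda-1/2}C_n^{(\lambda)}(x)f(x)\,dx$ with $h_n=\int_{-1}^1(1-x^2)^{\lambda-1/2}[C_n^{(\lambda)}(x)]^2dx=\frac{2^{1-2\lambda}\pi}{\Gamma(\lambda)^2}\frac{\Gamma(n+2\lambda)}{n!(n+\lambda)}$. The Chebyshev coefficients are those of $f=\sum_{n\ge0}c_nT_n$, i.e. $c_n=\frac2\pi\int_{-1}^1\frac{f(x)T_n(x)}{\sqrt{1-x^2}}dx$ for $n\ge1$. Constants in the $O$-terms may depend on everything except $n$. *)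

theory Defs
  imports "HOL-Analysis.Analysis"
begin

text \<open>
  The standard recurrence \<open>m C(m) = 2 (m + lam - 1) x C(m-1) - (m + 2 lam - 2) C(m-2)\<close>
  for \<open>m = n + 2\<close>, divided by \<open>m\<close>.
\<close>

fun gegenbauer :: "real \<Rightarrow> nat \<Rightarrow> real poly" where
  "gegenbauer lam 0 = 1"
| "gegenbauer lam (Suc 0) = [:0, 2 * lam:]"
| "gegenbauer lam (Suc (Suc n)) =
     smult (2 * (real n + 1 + lam) / (real n + 2)) ([:0, 1:] * gegenbauer lam (Suc n))
     - smult ((real n + 2 * lam) / (real n + 2)) (gegenbauer lam n)"

fun chebyshev_T :: "nat \<Rightarrow> real poly" where
  "chebyshev_T 0 = 1"
| "chebyshev_T (Suc 0) = [:0, 1:]"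
| "chebyshev_T (Suc (Suc n)) = [:0, 2:] * chebyshev_T (Suc n) - chebyshev_T n"

lemma poly_chebyshev_T_cos: "poly (chebyshev_T n) (cos t) = cos (real n * t)"
proof (induction n rule: chebyshev_T.induct)
  case (3 n)
  have "cos (real (Suc (Suc n)) * t) + cos (real n * t) = 2 * cos t * cos (real (Suc n) * t)"
    using cos_add[of "real (Suc n) * t" t] cos_diff[of "real (Suc n) * t" t]
    by (simp add: algebra_simps)
  with 3 show ?case by simp
qed simp_all

text \<open>
  The integrals below are Henstock--Kurzweil integrals, so the integrable endpoint
  singularities of the weights need no limit process.  The values at the endpoints
  themselves, where \<open>0 powr a = 0\<close> and \<open>x / 0 = 0\<close>, are immaterial.
\<close>

(* The squared weighted L2 norm h_n. *)
definition gegenbauer_norm :: "real \<Rightarrow> nat \<Rightarrow> real" where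
  "gegenbauer_norm lam n =
     integral {-1..1} (\<lambda>x. (1 - x\<^sup>2) powr (lam - 1/2) * (poly (gegenbauer lam n) x)\<^sup>2)"

definition gegenbauer_coeff :: "real \<Rightarrow> (real \<Rightarrow> real) \<Rightarrow> nat \<Rightarrow> real" where
  "gegenbauer_coeff lam f n =
     1 / gegenbauer_norm lam n *
     integral {-1..1} (\<lambda>x. (1 - x\<^sup>2) powr (lam - 1/2) * poly (gegenbauer lam n) x * f x)"

text \<open>
  The constant term has the factor \<open>1 / \<pi>\<close>, as required by the expansion
  \<open>f = (\<Sum>n. c n * T n)\<close> with an unhalved first term.
\<close>

definition chebyshev_coeff :: "(real \<Rightarrow> real) \<Rightarrow> nat \<Rightarrow> real" where
  "chebyshev_coeff f n =
     (if n = 0 then 1 else 2) / pi *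
     integral {-1..1} (\<lambda>x. f x * poly (chebyshev_T n) x / sqrt (1 - x\<^sup>2))"

text \<open>
  The functions \<open>G k\<close> are the successive derivatives of \<open>g\<close> on \<open>S\<close>, one-sided at the
  endpoints when \<open>S\<close> is a compact interval; continuity of each of them is implied.
\<close>

definition smooth_on_set :: "real set \<Rightarrow> (real \<Rightarrow> real) \<Rightarrow> bool" where
  "smooth_on_set S g \<longleftrightarrow>
     (\<exists>G :: nat \<Rightarrow> real \<Rightarrow> real.
        (\<forall>x\<in>S. G 0 x = g x) \<and>
        (\<forall>k. \<forall>x\<in>S. (G k has_real_derivative G (Suc k) x) (at x within S)))"

end

theory Submission
  imports Defs "HOL-Real_Asymp.Real_Asymp"
begin

text \<open>
  Let \<open>w \<nu> = (1 - x\<^sup>2) powr (\<nu> - 1/2)\<close>, and let \<open>p\<close> solve the Gegenbauer equation with eigenvalue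
  \<open>n (n + 2 lam)\<close> (for \<open>lam = 0\<close>, the Chebyshev equation). In divergence form the equation says that
  \<open>w (lam + 1) p'\<close> is an antiderivative of a multiple of \<open>w lam p\<close>; it vanishes at both endpoints,
  and \<open>p'\<close> solves the equation with parameter \<open>lam + 1\<close>. Hence \<open>w lam p\<close> has explicit iterated
  antiderivatives \<open>U k\<close>. A Sonin function bounds them by \<open>C n powr (-k)\<close> times the weighted
  norm \<open>sqrt h\<close> of \<open>p\<close>, uniformly on compact subintervals of the open interval and, for
  \<open>lam + k \<ge> 1\<close>, on the whole interval. No asymptotic formula for the polynomials is needed.

  Within distance \<open>1/n\<close> of the singularity the integrand is estimated directly, and outside one
  integrates by parts \<open>K > s + 1\<close> times; every contribution is
  \<open>O(sqrt h * ln n ^ \<mu> * n powr (-1 - s))\<close>. The Chebyshev norms are bounded, and the Gegenbauer norms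
  satisfy a two-term recurrence which gives \<open>h \<ge> c n powr (2 lam - 2)\<close>.
\<close>

subsection \<open>The weight and the differential equation\<close>

definition weight :: "real \<Rightarrow> real \<Rightarrow> real" where
  "weight \<nu> x = (1 - x\<^sup>2) powr (\<nu> - 1/2)"

lemma one_minus_square_pos: "x \<in> {-1<..<1} \<Longrightarrow> 1 - x\<^sup>2 > (0::real)"
  by (simp add: abs_square_less_1 abs_less_iff)

lemma one_minus_square_nonneg: "x \<in> {-1..1} \<Longrightarrow> 1 - x\<^sup>2 \<ge> (0::real)"
  by (simp add: abs_square_le_1 abs_le_iff)

lemma weight_nonneg: "weight \<nu> x \<ge> 0"
  by (simp add: weight_def)

lemma weight_minus [simp]: "weight \<nu> (-x) = weight \<nu> x"
  by (simp add: weight_def)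

text \<open>Since \<open>0 powr a = 0\<close> for every \<open>a\<close>, this holds even where the
  weight blows up near \<plusminus>1. Boundary terms and endpoint cases of pointwise inequalities
  thereby become trivial.\<close>

lemma weight_endpoint [simp]: "weight \<nu> 1 = 0" "weight \<nu> (-1) = 0"
  by (simp_all add: weight_def)

lemma weight_Suc: "x \<in> {-1..1} \<Longrightarrow> weight (\<nu> + 1) x = (1 - x\<^sup>2) * weight \<nu> x"
  using powr_mult_base[of "1 - x\<^sup>2" "\<nu> - 1/2"] one_minus_square_nonneg[of x]
  by (simp add: weight_def algebra_simps)

lemma weight_continuous_on: "S \<subseteq> {-1<..<1} \<Longrightarrow> continuous_on S (weight \<nu>)"
  unfolding weight_def
  by (rule continuous_on_powr) (use one_minus_square_pos in \<open>force intro!: continuous_intros\<close>)+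

lemma weight_continuous_on_closed: "\<nu> > 1/2 \<Longrightarrow> continuous_on {-1..1} (weight \<nu>)"
  unfolding weight_def
  by (rule continuous_on_powr') (use one_minus_square_nonneg in \<open>force intro!: continuous_intros\<close>)+

lemma weight_has_real_derivative:
  assumes "x \<in> {-1<..<1}"
  shows "(weight (\<nu> + 1) has_real_derivative - (2 * \<nu> + 1) * x * weight \<nu> x) (at x)"
proof -
  have "((\<lambda>x. 1 - x\<^sup>2) has_real_derivative - 2 * x) (at x)"
    by (auto intro!: derivative_eq_intros)
  from DERIV_fun_powr[OF this one_minus_square_pos[OF assms], of "\<nu> + 1/2"]
  show ?thesis
    unfolding weight_def by (simp add: algebra_simps)
qed

text \<open>The substitution x = 2t - 1 turns 1 - x^2 into 4t(1 - t), so the total mass is a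
  constant times a Beta integral, finite and positive because \<nu> + 1/2 > 0.\<close>

lemma weight_has_integral:
  assumes "\<nu> > -1/2"
  shows "\<exists>I>0. (weight \<nu> has_integral I) {-1..1}"
proof -
  define a where "a = \<nu> + 1/2"
  have a: "a > 0" using assms by (simp add: a_def)
  have "((\<lambda>t. t powr (a - 1) * (1 - t) powr (a - 1)) has_integral Beta a a) (cbox 0 1)"
    using has_integral_Beta_real[OF a a] by simp
  from has_integral_affinity[OF this, of "1/2" "1/2"]
  have "((\<lambda>x. (x/2 + 1/2) powr (a - 1) * (1 - (x/2 + 1/2)) powr (a - 1)) has_integral 2 * Beta a a)
      ((\<lambda>x. 2 * x + - 1) ` {0..1})"
    by simp
  moreover have "(\<lambda>x. 2 * x + - 1) ` {0..1::real} = {-1..1}"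
    using image_affinity_atLeastAtMost[of 2 "-1" "0::real" 1] by simp
  ultimately have *: "((\<lambda>x. (x/2 + 1/2) powr (a - 1) * (1 - (x/2 + 1/2)) powr (a - 1))
      has_integral 2 * Beta a a) {-1..1}"
    by simp
  have "((\<lambda>x. 4 powr (a - 1) * ((x/2 + 1/2) powr (a - 1) * (1 - (x/2 + 1/2)) powr (a - 1)))
      has_integral 4 powr (a - 1) * (2 * Beta a a)) {-1..1}"
    by (rule has_integral_mult_right[OF *])
  moreover have "4 powr (a - 1) * ((x/2 + 1/2) powr (a - 1) * (1 - (x/2 + 1/2)) powr (a - 1))
      = weight \<nu> x" if "x \<in> {-1..1}" for x :: real
  proof -
    have "4 powr (a - 1) * ((x/2 + 1/2) powr (a - 1) * (1 - (x/2 + 1/2)) powr (a - 1))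
        = (4 * ((x/2 + 1/2) * (1 - (x/2 + 1/2)))) powr (a - 1)"
      using that by (simp add: powr_mult)
    also have "4 * ((x/2 + 1/2) * (1 - (x/2 + 1/2))) = 1 - x\<^sup>2"
      by (simp add: field_simps power2_eq_square)
    finally show ?thesis by (simp add: weight_def a_def)
  qed
  ultimately have "(weight \<nu> has_integral 4 powr (a - 1) * (2 * Beta a a)) {-1..1}"
    by (rule has_integral_eq[rotated])
  moreover have "Beta a a > 0"
    using a by (simp add: Beta_def)
  ultimately show ?thesis by (intro exI[of _ "4 powr (a - 1) * (2 * Beta a a)"]) simp
qed

lemma weight_mult_absolutely_integrable:
  assumes "\<nu> > -1/2" "-1 \<le> a" "b \<le> 1" "continuous_on {a..b} h"
  shows "(\<lambda>x. weight \<nu> x * h x) absolutely_integrable_on {a..b}"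
proof -
  have "weight \<nu> absolutely_integrable_on {-1..1}"
    using weight_has_integral[OF assms(1)]
    by (intro nonnegative_absolutely_integrable_1) (auto simp: weight_nonneg)
  then have "weight \<nu> absolutely_integrable_on {a..b}"
    by (rule absolutely_integrable_on_subinterval) (use assms in auto)
  moreover have "bounded (h ` {a..b})"
    using assms(4) by (intro compact_imp_bounded compact_continuous_image) auto
  moreover have "h \<in> borel_measurable (lebesgue_on {a..b})"
    using assms(4) by (intro continuous_imp_measurable_on_sets_lebesgue) auto
  ultimately show ?thesis
    using absolutely_integrable_bounded_measurable_product_real[of h "{a..b}" "weight \<nu>"]
    by (simp add: mult.commute)
qed

lemma weight_mult_integrable:
  assumes "\<nu> > -1/2" "-1 \<le> a" "b \<le> 1" "continuous_on {a..b} h"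
  shows "(\<lambda>x. weight \<nu> x * h x) integrable_on {a..b}"
  using weight_mult_absolutely_integrable[OF assms] by (rule set_lebesgue_integral_eq_integral(1))

text \<open>For \<open>M = n (n + 2 \<nu>)\<close> this is the Gegenbauer equation, and for \<open>\<nu> = 0\<close>, \<open>M = n\<^sup>2\<close> the Chebyshev
  equation.\<close>

definition gegenbauer_ode :: "real \<Rightarrow> real \<Rightarrow> real poly \<Rightarrow> bool" where
  "gegenbauer_ode \<nu> M p \<longleftrightarrow>
     [:1, 0, -1:] * pderiv (pderiv p) - smult (2 * \<nu> + 1) ([:0, 1:] * pderiv p) + smult M p = 0"

lemma gegenbauer_ode_poly:
  "gegenbauer_ode \<nu> M p \<Longrightarrow>
    (1 - x\<^sup>2) * poly (pderiv (pderiv p)) x = (2 * \<nu> + 1) * x * poly (pderiv p) x - M * poly p x"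
  unfolding gegenbauer_ode_def
  by (drule arg_cong[of _ _ "\<lambda>q. poly q x"]) (simp add: power2_eq_square algebra_simps)

text \<open>A polynomial with infinitely many zeros is 0, so the equation may be checked pointwise
  on the open interval, where substitutions such as x = cos t are available.\<close>

lemma gegenbauer_odeI:
  assumes "\<And>x. x \<in> {-1<..<1} \<Longrightarrow>
    (1 - x\<^sup>2) * poly (pderiv (pderiv p)) x = (2 * \<nu> + 1) * x * poly (pderiv p) x - M * poly p x"
  shows "gegenbauer_ode \<nu> M p"
proof -
  define q where
    "q = [:1, 0, -1:] * pderiv (pderiv p) - smult (2 * \<nu> + 1) ([:0, 1:] * pderiv p) + smult M p"
  have "{-1<..<1} \<subseteq> {x. poly q x = 0}"
    using assms by (auto simp: q_def power2_eq_square algebra_simps)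
  moreover have "infinite {-1<..<1::real}" by simp
  ultimately have "infinite {x. poly q x = 0}" using finite_subset by blast
  then have "q = 0" using poly_roots_finite by blast
  then show ?thesis by (simp add: gegenbauer_ode_def q_def)
qed

text \<open>Differentiate the equation once: the factor 1 - x^2 contributes -2x p'', which raises
  2\<nu> + 1 by 2, and the factor x moves (2\<nu> + 1) p' into the eigenvalue term.\<close>

lemma gegenbauer_ode_pderiv:
  assumes "gegenbauer_ode \<nu> M p"
  shows "gegenbauer_ode (\<nu> + 1) (M - (2 * \<nu> + 1)) (pderiv p)"
proof (rule gegenbauer_odeI)
  fix x :: real
  have "pderiv ([:1, 0, -1:] * pderiv (pderiv p) - smult (2 * \<nu> + 1) ([:0, 1:] * pderiv p)
      + smult M p) = 0"
    using assms by (simp add: gegenbauer_ode_def)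
  from arg_cong[OF this, of "\<lambda>q. poly q x"]
  show "(1 - x\<^sup>2) * poly (pderiv (pderiv (pderiv p))) x =
      (2 * (\<nu> + 1) + 1) * x * poly (pderiv (pderiv p)) x - (M - (2 * \<nu> + 1)) * poly (pderiv p) x"
    by (simp add: pderiv_add pderiv_diff pderiv_minus pderiv_mult pderiv_smult pderiv_pCons
        power2_eq_square algebra_simps)
qed

lemma poly_reflect: "poly (pcompose p [:0, -1:]) x = poly p (-x)" for p :: "real poly"
  by (simp add: poly_pcompose)

lemma gegenbauer_ode_reflect:
  assumes "gegenbauer_ode \<nu> M p"
  shows "gegenbauer_ode \<nu> M (pcompose p [:0, -1:])"
proof (rule gegenbauer_odeI)
  fix x :: real
  show "(1 - x\<^sup>2) * poly (pderiv (pderiv (pcompose p [:0, -1:]))) x =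
      (2 * \<nu> + 1) * x * poly (pderiv (pcompose p [:0, -1:])) x - M * poly (pcompose p [:0, -1:]) x"
    using gegenbauer_ode_poly[OF assms, of "-x"]
    by (simp add: pderiv_pcompose pderiv_pCons pderiv_mult pderiv_minus poly_pcompose algebra_simps)
qed

text \<open>The divergence form: \<open>weight \<nu>\<close> is the integrating factor, because the
  derivative of \<open>weight (\<nu> + 1)\<close> is exactly the first-order coefficient times
  \<open>weight \<nu>\<close>.\<close>

lemma gegenbauer_ode_has_real_derivative:
  assumes "gegenbauer_ode \<nu> M p" "x \<in> {-1<..<1}"
  shows "((\<lambda>x. weight (\<nu> + 1) x * poly (pderiv p) x)
    has_real_derivative - M * (weight \<nu> x * poly p x)) (at x)"
proof -
  have "((\<lambda>x. weight (\<nu> + 1) x * poly (pderiv p) x) has_real_derivative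
      (- (2 * \<nu> + 1) * x * weight \<nu> x) * poly (pderiv p) x
      + poly (pderiv (pderiv p)) x * weight (\<nu> + 1) x) (at x)"
    by (intro DERIV_mult weight_has_real_derivative poly_DERIV assms)
  also have "(- (2 * \<nu> + 1) * x * weight \<nu> x) * poly (pderiv p) x
      + poly (pderiv (pderiv p)) x * weight (\<nu> + 1) x
      = weight \<nu> x * ((1 - x\<^sup>2) * poly (pderiv (pderiv p)) x - (2 * \<nu> + 1) * x * poly (pderiv p) x)"
    using assms by (subst weight_Suc) (auto simp: algebra_simps)
  also have "\<dots> = - M * (weight \<nu> x * poly p x)"
    unfolding gegenbauer_ode_poly[OF assms(1)] by (simp add: algebra_simps)
  finally show ?thesis .
qed

section \<open>Weighted inner products and Green's identity\<close>

definition weighted_inner :: "real \<Rightarrow> real poly \<Rightarrow> real poly \<Rightarrow> real" where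
  "weighted_inner \<nu> p q = integral {-1..1} (\<lambda>x. weight \<nu> x * (poly p x * poly q x))"

lemma weighted_inner_integrable:
  "\<nu> > -1/2 \<Longrightarrow> (\<lambda>x. weight \<nu> x * (poly p x * poly q x)) integrable_on {-1..1}"
  by (rule weight_mult_integrable) (auto intro!: continuous_intros)

lemma weighted_inner_commute: "weighted_inner \<nu> p q = weighted_inner \<nu> q p"
  by (simp add: weighted_inner_def mult.commute)

lemma weighted_inner_mult_left: "weighted_inner \<nu> (r * p) q = weighted_inner \<nu> p (r * q)"
  by (simp add: weighted_inner_def mult.left_commute mult.assoc)

lemma weighted_inner_smult: "weighted_inner \<nu> (smult c p) q = c * weighted_inner \<nu> p q"
  unfolding weighted_inner_def poly_smult
  by (subst integral_mult_right[symmetric]) (simp add: algebra_simps)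

lemma weighted_inner_diff:
  assumes "\<nu> > -1/2"
  shows "weighted_inner \<nu> (p1 - p2) q = weighted_inner \<nu> p1 q - weighted_inner \<nu> p2 q"
  unfolding weighted_inner_def
  by (subst integral_diff[symmetric])
     (use weighted_inner_integrable[OF assms] in \<open>simp_all add: algebra_simps\<close>)

lemma weighted_inner_nonneg: "\<nu> > -1/2 \<Longrightarrow> weighted_inner \<nu> p p \<ge> 0"
  unfolding weighted_inner_def
  by (intro integral_nonneg weighted_inner_integrable) (auto intro: mult_nonneg_nonneg weight_nonneg)

text \<open>Integrate the derivative of \<open>weight (\<nu> + 1)\<close> p' q over the interval;
  the boundary terms vanish with the weight. Taking q = p gives the norm of p', and two solutions in
  either order give orthogonality.\<close>

lemma weighted_inner_pderiv:
  assumes "\<nu> > -1/2" "gegenbauer_ode \<nu> M p"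
  shows "weighted_inner (\<nu> + 1) (pderiv p) (pderiv q) = M * weighted_inner \<nu> p q"
proof -
  have int: "(\<lambda>x. weight (\<nu> + 1) x * (poly (pderiv p) x * poly (pderiv q) x)) integrable_on {-1..1}"
    using assms by (intro weighted_inner_integrable) auto
  have "((\<lambda>x. weight (\<nu> + 1) x * (poly (pderiv p) x * poly (pderiv q) x)
        - M * (weight \<nu> x * (poly p x * poly q x))) has_integral
      weight (\<nu> + 1) 1 * poly (pderiv p) 1 * poly q 1
      - weight (\<nu> + 1) (-1) * poly (pderiv p) (-1) * poly q (-1)) {-1..1}"
  proof (rule fundamental_theorem_of_calculus_interior)
    show "continuous_on {-1..1} (\<lambda>x. weight (\<nu> + 1) x * poly (pderiv p) x * poly q x)"
      using assms by (intro continuous_intros weight_continuous_on_closed) auto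
    fix x :: real assume "x \<in> {-1<..<1}"
    from DERIV_mult[OF gegenbauer_ode_has_real_derivative[OF assms(2) this] poly_DERIV[of q]]
    show "((\<lambda>x. weight (\<nu> + 1) x * poly (pderiv p) x * poly q x) has_vector_derivative
      weight (\<nu> + 1) x * (poly (pderiv p) x * poly (pderiv q) x)
        - M * (weight \<nu> x * (poly p x * poly q x))) (at x)"
      unfolding has_real_derivative_iff_has_vector_derivative[symmetric] 
      by (simp add: algebra_simps)
  qed simp
  from integral_unique[OF this] show ?thesis
    using int weighted_inner_integrable[OF assms(1), of p q]
    by (simp add: integral_diff weighted_inner_def integrable_on_mult_right)
qed

subsection \<open>Pointwise bounds from the Sonin function\<close>

text \<open>As \<open>weight (b + 1/2)\<close> is (1 - x^2)^b, this is the product rule with (1 -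
  x^2)^(b - 1) factored out, so that the sign of the derivative can be read off the bracket.\<close>

lemma weight_mult_has_real_derivative:
  assumes "(\<Phi> has_real_derivative d) (at x)" "x \<in> {-1<..<1}"
  shows "((\<lambda>x. weight (b + 1/2) x * \<Phi> x)
    has_real_derivative weight (b - 1/2) x * ((1 - x\<^sup>2) * d - 2 * b * x * \<Phi> x)) (at x)"
proof -
  have "weight (b + 1/2) x = (1 - x\<^sup>2) * weight (b - 1/2) x"
    using weight_Suc[of x "b - 1/2"] assms by (simp add: add.commute)
  with DERIV_mult[OF weight_has_real_derivative[OF assms(2), of "b - 1/2"] assms(1)]
  show ?thesis by (simp add: algebra_simps)
qed

text \<open>A Gronwall argument: the hypothesis bounds the logarithmic derivative of \<Phi> by that
  of (1 - x^2)^(-a). Hence on [0, 1) the product (1 - x^2)^a \<Phi> decreases and (1 - x^2)^(-a)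
  \<Phi> increases, and both are compared with their value \<Phi>(0) at the origin.\<close>

lemma derivative_comparison_nonneg:
  fixes \<Phi> \<Phi>' :: "real \<Rightarrow> real"
  assumes deriv: "\<And>x. x \<in> {-1<..<1} \<Longrightarrow> (\<Phi> has_real_derivative \<Phi>' x) (at x)"
    and bound: "\<And>x. x \<in> {-1<..<1} \<Longrightarrow> (1 - x\<^sup>2) * \<bar>\<Phi>' x\<bar> \<le> 2 * a * \<bar>x\<bar> * \<Phi> x"
    and x: "0 \<le> x" "x < 1"
  shows "weight (a + 1/2) x * \<Phi> x \<le> \<Phi> 0" and "weight (a + 1/2) x * \<Phi> 0 \<le> \<Phi> x"
proof -
  have bd: "\<bar>(1 - y\<^sup>2) * \<Phi>' y\<bar> \<le> 2 * a * y * \<Phi> y" if "0 \<le> y" "y \<le> x" for y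
    using bound[of y] that x one_minus_square_nonneg[of y] by (simp add: abs_mult)
  have "weight (a + 1/2) x * \<Phi> x \<le> weight (a + 1/2) 0 * \<Phi> 0"
  proof (rule DERIV_nonpos_imp_nonincreasing[OF x(1)])
    fix y assume y: "0 \<le> y" "y \<le> x"
    show "\<exists>d. ((\<lambda>x. weight (a + 1/2) x * \<Phi> x) has_real_derivative d) (at y) \<and> d \<le> 0"
      using weight_mult_has_real_derivative[OF deriv, of y a] bd[OF y] y x
      by (intro exI conjI) (auto intro!: mult_nonneg_nonpos weight_nonneg)
  qed
  then show "weight (a + 1/2) x * \<Phi> x \<le> \<Phi> 0"
    by (simp add: weight_def)
  have "weight (-a + 1/2) 0 * \<Phi> 0 \<le> weight (-a + 1/2) x * \<Phi> x"
  proof (rule DERIV_nonneg_imp_nondecreasing[OF x(1)])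
    fix y assume y: "0 \<le> y" "y \<le> x"
    show "\<exists>d. ((\<lambda>x. weight (-a + 1/2) x * \<Phi> x) has_real_derivative d) (at y) \<and> d \<ge> 0"
    proof (intro exI conjI)
      show "((\<lambda>x. weight (-a + 1/2) x * \<Phi> x) has_real_derivative
          weight (-a - 1/2) y * ((1 - y\<^sup>2) * \<Phi>' y - 2 * (-a) * y * \<Phi> y)) (at y)"
        using y x by (intro weight_mult_has_real_derivative deriv) auto
      show "weight (-a - 1/2) y * ((1 - y\<^sup>2) * \<Phi>' y - 2 * (-a) * y * \<Phi> y) \<ge> 0"
        using bd[OF y] by (intro mult_nonneg_nonneg weight_nonneg) auto
    qed
  qed
  moreover have "1 - x\<^sup>2 > 0" using x by (intro one_minus_square_pos) auto
  ultimately show "weight (a + 1/2) x * \<Phi> 0 \<le> \<Phi> x"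
    by (simp add: weight_def powr_minus field_simps)
qed

lemma derivative_comparison:
  fixes \<Phi> \<Phi>' :: "real \<Rightarrow> real"
  assumes deriv: "\<And>x. x \<in> {-1<..<1} \<Longrightarrow> (\<Phi> has_real_derivative \<Phi>' x) (at x)"
    and bound: "\<And>x. x \<in> {-1<..<1} \<Longrightarrow> (1 - x\<^sup>2) * \<bar>\<Phi>' x\<bar> \<le> 2 * a * \<bar>x\<bar> * \<Phi> x"
    and x: "x \<in> {-1<..<1}"
  shows "weight (a + 1/2) x * \<Phi> x \<le> \<Phi> 0" and "weight (a + 1/2) x * \<Phi> 0 \<le> \<Phi> x"
proof -
  have deriv': "((\<lambda>x. \<Phi> (- x)) has_real_derivative - \<Phi>' (- y)) (at y)" if "y \<in> {-1<..<1}" for y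
    using DERIV_mirror[of \<Phi> "\<Phi>' (- y)" y] deriv[of "-y"] that by simp
  have bound': "(1 - y\<^sup>2) * \<bar>- \<Phi>' (- y)\<bar> \<le> 2 * a * \<bar>y\<bar> * \<Phi> (- y)" if "y \<in> {-1<..<1}" for y
    using bound[of "-y"] that by simp
  show "weight (a + 1/2) x * \<Phi> x \<le> \<Phi> 0" "weight (a + 1/2) x * \<Phi> 0 \<le> \<Phi> x"
    using derivative_comparison_nonneg[OF deriv bound, of x] x
      derivative_comparison_nonneg[of "\<lambda>x. \<Phi> (- x)" "\<lambda>y. - \<Phi>' (- y)" a "-x", OF deriv' bound']
    by (cases "x \<ge> 0"; simp)+
qed

text \<open>\<open>\<Phi> = p\<^sup>2 + (1 - x\<^sup>2) p'\<^sup>2 / M\<close> has \<open>\<Phi>' = 4 \<nu> x p'\<^sup>2 / M\<close>, because the terms with \<open>p p'\<close>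
  cancel, so \<open>\<Phi>\<close> varies on compact subintervals by a factor independent of \<open>M\<close>; and
  the weighted integral of \<open>\<Phi>\<close> is twice the squared norm of \<open>p\<close>.\<close>

definition sonin :: "real \<Rightarrow> real poly \<Rightarrow> real \<Rightarrow> real" where
  "sonin M p x = (poly p x)\<^sup>2 + (1 - x\<^sup>2) / M * (poly (pderiv p) x)\<^sup>2"

lemma sonin_has_real_derivative:
  assumes "gegenbauer_ode \<nu> M p" "M > 0"
  shows "(sonin M p has_real_derivative 4 * \<nu> * x / M * (poly (pderiv p) x)\<^sup>2) (at x)"
proof -
  have "(sonin M p has_real_derivative 2 * poly p x * poly (pderiv p) x
      + (- 2 * x / M * (poly (pderiv p) x)\<^sup>2
      + (1 - x\<^sup>2) / M * (2 * poly (pderiv p) x * poly (pderiv (pderiv p)) x))) (at x)"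
    unfolding sonin_def[abs_def] using assms(2)
    by (auto intro!: derivative_eq_intros poly_DERIV simp: power2_eq_square field_simps)
  also have "2 * poly p x * poly (pderiv p) x
      + (- 2 * x / M * (poly (pderiv p) x)\<^sup>2
      + (1 - x\<^sup>2) / M * (2 * poly (pderiv p) x * poly (pderiv (pderiv p)) x))
      = 2 * poly p x * poly (pderiv p) x - 2 * x / M * (poly (pderiv p) x)\<^sup>2
      + 2 / M * poly (pderiv p) x * ((1 - x\<^sup>2) * poly (pderiv (pderiv p)) x)"
    by simp
  also have "\<dots> = 4 * \<nu> * x / M * (poly (pderiv p) x)\<^sup>2"
    unfolding gegenbauer_ode_poly[OF assms(1)] using assms(2)
    by (simp add: field_simps power2_eq_square)
  finally show ?thesis .
qed

text \<open>The lower comparison, integrated against \<open>weight \<nu>\<close>, bounds the Sonin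
  function at 0 by its weighted integral, which is twice the squared norm; the upper comparison
  carries this from 0 to x. The constant is independent of M and p.\<close>

lemma sonin_bound:
  assumes "\<nu> > -1/2"
  shows "\<exists>C>0. \<forall>M p x. M > 0 \<longrightarrow> gegenbauer_ode \<nu> M p \<longrightarrow> x \<in> {-1<..<1} \<longrightarrow>
    weight (2 * \<bar>\<nu>\<bar> + 1/2) x * sonin M p x \<le> C * weighted_inner \<nu> p p"
proof -
  obtain c where c: "c > 0" "(weight (\<nu> + 2 * \<bar>\<nu>\<bar>) has_integral c) {-1..1}"
    using weight_has_integral[of "\<nu> + 2 * \<bar>\<nu>\<bar>"] assms by fastforce
  have "weight (2 * \<bar>\<nu>\<bar> + 1/2) x * sonin M p x \<le> 2 / c * weighted_inner \<nu> p p"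
    if M: "M > 0" and ode: "gegenbauer_ode \<nu> M p" and x: "x \<in> {-1<..<1}" for M p x
  proof -
    \<comment> \<open>The exponent a = 2|\<nu>| arises here: the derivative is 4 \<nu> y p'^2 / M,
      and (1 - y^2) p'^2 / M is one of the two nonnegative summands of the Sonin function.\<close>
    have bound: "(1 - y\<^sup>2) * \<bar>4 * \<nu> * y / M * (poly (pderiv p) y)\<^sup>2\<bar> \<le>
        2 * (2 * \<bar>\<nu>\<bar>) * \<bar>y\<bar> * sonin M p y" if y: "y \<in> {-1<..<1}" for y
    proof -
      have "(1 - y\<^sup>2) * \<bar>4 * \<nu> * y / M * (poly (pderiv p) y)\<^sup>2\<bar>
          = 4 * \<bar>\<nu>\<bar> * \<bar>y\<bar> * ((1 - y\<^sup>2) / M * (poly (pderiv p) y)\<^sup>2)"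
        using M by (simp add: abs_mult)
      also have "\<dots> \<le> 4 * \<bar>\<nu>\<bar> * \<bar>y\<bar> * sonin M p y"
        by (intro mult_left_mono) (auto simp: sonin_def)
      finally show ?thesis by simp
    qed
    note cmp = derivative_comparison[where a = "2 * \<bar>\<nu>\<bar>", OF sonin_has_real_derivative[OF ode M] bound]
    have int: "((\<lambda>y. weight \<nu> y * (poly p y * poly p y)
        + 1 / M * (weight (\<nu> + 1) y * (poly (pderiv p) y * poly (pderiv p) y))) has_integral
        weighted_inner \<nu> p p + 1 / M * (weighted_inner (\<nu> + 1) (pderiv p) (pderiv p))) {-1..1}"
      unfolding weighted_inner_def using assms
      by (intro has_integral_add has_integral_mult_right integrable_integral weighted_inner_integrable) auto
    have "sonin M p 0 * c \<le>
        weighted_inner \<nu> p p + 1 / M * (weighted_inner (\<nu> + 1) (pderiv p) (pderiv p))"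
    proof (rule has_integral_le[OF has_integral_mult_right[OF c(2)] int])
      fix y :: real assume y: "y \<in> {-1..1}"
      show "sonin M p 0 * weight (\<nu> + 2 * \<bar>\<nu>\<bar>) y \<le> weight \<nu> y * (poly p y * poly p y)
        + 1 / M * (weight (\<nu> + 1) y * (poly (pderiv p) y * poly (pderiv p) y))"
      proof (cases "y \<in> {-1<..<1}")
        case True
        have "weight (\<nu> + 2 * \<bar>\<nu>\<bar>) y = weight \<nu> y * weight (2 * \<bar>\<nu>\<bar> + 1/2) y"
          by (simp add: weight_def powr_add[symmetric] algebra_simps)
        then have "sonin M p 0 * weight (\<nu> + 2 * \<bar>\<nu>\<bar>) y
            = weight \<nu> y * (weight (2 * \<bar>\<nu>\<bar> + 1/2) y * sonin M p 0)"
          by simp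
        also have "\<dots> \<le> weight \<nu> y * sonin M p y"
          by (intro mult_left_mono cmp(2)[OF _ True] weight_nonneg)
        also have "\<dots> = weight \<nu> y * (poly p y * poly p y)
            + 1 / M * (weight (\<nu> + 1) y * (poly (pderiv p) y * poly (pderiv p) y))"
          unfolding sonin_def weight_Suc[OF y] power2_eq_square by (simp add: distrib_left)
        finally show ?thesis .
      next
        case False
        with y have "y = 1 \<or> y = -1" by auto
        then show ?thesis by auto
      qed
    qed
    \<comment> \<open>By Green's identity the derivative term contributes M times the squared norm
      of p, so after division by M both summands agree.\<close>
    also have "\<dots> = 2 * weighted_inner \<nu> p p"
      using M by (simp add: weighted_inner_pderiv[OF assms ode])
    finally have "sonin M p 0 \<le> 2 / c * weighted_inner \<nu> p p"
      using c(1) by (simp add: field_simps)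
    with cmp(1)[OF _ x] show ?thesis by simp
  qed
  with c(1) show ?thesis by (intro exI[of _ "2 / c"]) auto
qed

text \<open>The Sonin function dominates p^2, and on the compact interval [-r, r] the ratio of the
  two weights involved is continuous, hence bounded.\<close>

lemma gegenbauer_ode_interior_bound:
  assumes "\<nu> > -1/2" "r < 1"
  shows "\<exists>C>0. \<forall>M p x. M > 0 \<longrightarrow> gegenbauer_ode \<nu> M p \<longrightarrow> x \<in> {-r..r} \<longrightarrow>
    \<bar>weight \<nu> x * poly p x\<bar> \<le> C * sqrt (weighted_inner \<nu> p p)"
proof -
  obtain C where C: "C > 0" "\<And>M p x. M > 0 \<Longrightarrow> gegenbauer_ode \<nu> M p \<Longrightarrow> x \<in> {-1<..<1} \<Longrightarrow>
      weight (2 * \<bar>\<nu>\<bar> + 1/2) x * sonin M p x \<le> C * weighted_inner \<nu> p p"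
    using sonin_bound[OF assms(1)] by auto
  have sub: "{-r..r} \<subseteq> {-1<..<1}" using assms by auto
  have pos: "weight (2 * \<bar>\<nu>\<bar> + 1/2) x > 0" if "x \<in> {-r..r}" for x
    using one_minus_square_pos[of x] that sub by (auto simp: weight_def)
  have "bounded ((\<lambda>x. (weight \<nu> x)\<^sup>2 / weight (2 * \<bar>\<nu>\<bar> + 1/2) x) ` {-r..r})"
    using pos by (intro compact_imp_bounded compact_continuous_image continuous_intros
        weight_continuous_on sub) (force, simp)
  then obtain D where D: "D > 0"
    "\<And>x. x \<in> {-r..r} \<Longrightarrow> (weight \<nu> x)\<^sup>2 / weight (2 * \<bar>\<nu>\<bar> + 1/2) x \<le> D"
    unfolding bounded_pos by (auto simp: abs_of_nonneg[OF weight_nonneg])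
  have "\<bar>weight \<nu> x * poly p x\<bar> \<le> sqrt (D * C) * sqrt (weighted_inner \<nu> p p)"
    if "M > 0" "gegenbauer_ode \<nu> M p" "x \<in> {-r..r}" for M p x
  proof -
    let ?w = "weight (2 * \<bar>\<nu>\<bar> + 1/2) x"
    have x: "x \<in> {-1<..<1}" using sub that by auto
    have "(weight \<nu> x * poly p x)\<^sup>2 = ((weight \<nu> x)\<^sup>2 / ?w) * (?w * (poly p x)\<^sup>2)"
      using pos[OF that(3)] by (simp add: power_mult_distrib)
    also have "\<dots> \<le> D * (?w * sonin M p x)"
      using one_minus_square_pos[OF x] that D
      by (intro mult_mono D mult_nonneg_nonneg weight_nonneg) (auto simp: sonin_def)
    also have "\<dots> \<le> D * (C * weighted_inner \<nu> p p)"
      using D(1) C(2)[OF that(1,2) x] by simp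
    finally have "sqrt ((weight \<nu> x * poly p x)\<^sup>2) \<le> sqrt (D * (C * weighted_inner \<nu> p p))"
      by (rule real_sqrt_le_mono)
    then show ?thesis by (simp add: real_sqrt_mult)
  qed
  with D(1) C(1) show ?thesis by (intro exI[of _ "sqrt (D * C)"]) simp
qed

text \<open>Here the other summand (1 - x^2) p'^2 / M of the Sonin function is used. For \<nu> \<ge>
  0 the comparison weight (1 - x^2)^(2\<nu>) times 1 - x^2 is exactly the square of
  \<open>weight (\<nu> + 1)\<close>, so nothing is lost at the endpoints, and the factor M is
  absorbed by the norm of p'.\<close>

lemma gegenbauer_ode_pderiv_bound:
  assumes "\<nu> \<ge> 0"
  shows "\<exists>C>0. \<forall>M p x. M > 0 \<longrightarrow> gegenbauer_ode \<nu> M p \<longrightarrow> x \<in> {-1..1} \<longrightarrow>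
    \<bar>weight (\<nu> + 1) x * poly (pderiv p) x\<bar>
      \<le> C * sqrt (weighted_inner (\<nu> + 1) (pderiv p) (pderiv p))"
proof -
  have \<nu>: "\<nu> > -1/2" using assms by simp
  obtain C where C: "C > 0" "\<And>M p x. M > 0 \<Longrightarrow> gegenbauer_ode \<nu> M p \<Longrightarrow> x \<in> {-1<..<1} \<Longrightarrow>
      weight (2 * \<bar>\<nu>\<bar> + 1/2) x * sonin M p x \<le> C * weighted_inner \<nu> p p"
    using sonin_bound[OF \<nu>] by auto
  have "\<bar>weight (\<nu> + 1) x * poly (pderiv p) x\<bar>
      \<le> sqrt C * sqrt (weighted_inner (\<nu> + 1) (pderiv p) (pderiv p))"
    if M: "M > 0" and ode: "gegenbauer_ode \<nu> M p" and x: "x \<in> {-1..1}" for M p x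
  proof (cases "x \<in> {-1<..<1}")
    case True
    have "(weight (\<nu> + 1) x * poly (pderiv p) x)\<^sup>2
        = weight (2 * \<bar>\<nu>\<bar> + 1/2) x * (1 - x\<^sup>2) * (poly (pderiv p) x)\<^sup>2"
    proof -
      have "(weight (\<nu> + 1) x)\<^sup>2 = (1 - x\<^sup>2) powr (2 * \<nu> + 1)"
        by (simp add: weight_def power2_eq_square[of "_ powr _"] add.commute flip: powr_add)
      also have "\<dots> = weight (2 * \<bar>\<nu>\<bar> + 1/2) x * (1 - x\<^sup>2)"
        using assms one_minus_square_pos[OF True] by (simp add: weight_def powr_add)
      finally show ?thesis by (simp add: power_mult_distrib)
    qed
    also have "\<dots> = M * (weight (2 * \<bar>\<nu>\<bar> + 1/2) x * ((1 - x\<^sup>2) / M * (poly (pderiv p) x)\<^sup>2))"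
      using M by simp
    also have "\<dots> \<le> M * (weight (2 * \<bar>\<nu>\<bar> + 1/2) x * sonin M p x)"
      using M by (intro mult_left_mono weight_nonneg) (auto simp: sonin_def)
    also have "\<dots> \<le> M * (C * weighted_inner \<nu> p p)"
      using M C(2)[OF M ode True] by simp
    also have "\<dots> = C * weighted_inner (\<nu> + 1) (pderiv p) (pderiv p)"
      by (simp add: weighted_inner_pderiv[OF \<nu> ode])
    finally have "sqrt ((weight (\<nu> + 1) x * poly (pderiv p) x)\<^sup>2)
        \<le> sqrt (C * weighted_inner (\<nu> + 1) (pderiv p) (pderiv p))"
      by (rule real_sqrt_le_mono)
    then show ?thesis by (simp add: real_sqrt_mult)
  next
    case False
    with x have "x = 1 \<or> x = -1" by auto
    then show ?thesis
      using C(1) assms by (auto intro!: mult_nonneg_nonneg weighted_inner_nonneg)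
  qed
  with C(1) show ?thesis by (intro exI[of _ "sqrt C"]) simp
qed

subsection \<open>Logarithmic singularities and integration by parts\<close>

text \<open>One differentiation produces three functions of the same shape: the exponent drops with
  the same logarithm, the exponent and the log power both drop, or \<open>G j\<close> becomes
  \<open>G (Suc j)\<close>. Induction on k, for all \<sigma>, m and j at once, therefore supplies
  the remaining derivatives, each costing one power of x - z.\<close>

lemma powr_log_power_derivatives:
  fixes G :: "nat \<Rightarrow> real \<Rightarrow> real"
  assumes z: "-1 \<le> z"
    and deriv: "\<And>j x. x \<in> {z<..<1} \<Longrightarrow> (G j has_real_derivative G (Suc j) x) (at x)"
    and cont: "\<And>j. continuous_on {z..1} (G j)"
  shows "\<exists>F C. F 0 = (\<lambda>x. (x - z) powr \<sigma> * ln (x - z) ^ m * G j x) \<and> C \<ge> 0 \<and>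
    (\<forall>i<k. \<forall>x\<in>{z<..<1}. (F i has_real_derivative F (Suc i) x) (at x)) \<and>
    (\<forall>i\<le>k. continuous_on {z<..1} (F i)) \<and>
    (\<forall>i\<le>k. \<forall>x\<in>{z<..1}. \<bar>F i x\<bar> \<le> C * (x - z) powr (\<sigma> - real i) * (1 + \<bar>ln (x - z)\<bar>) ^ m)"
proof (induction k arbitrary: \<sigma> m j)
  case base: 0
  have "bounded (G j ` {z..1})"
    using cont by (intro compact_imp_bounded compact_continuous_image) auto
  then obtain B where B: "B > 0" "\<And>x. x \<in> {z..1} \<Longrightarrow> \<bar>G j x\<bar> \<le> B"
    unfolding bounded_pos by auto
  define F where "F = (\<lambda>i::nat. \<lambda>x. (x - z) powr \<sigma> * ln (x - z) ^ m * G j x)"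
  have "continuous_on {z<..1} (F 0)"
    unfolding F_def by (intro continuous_intros continuous_on_subset[OF cont]) auto
  moreover have "\<bar>F 0 x\<bar> \<le> B * (x - z) powr (\<sigma> - real 0) * (1 + \<bar>ln (x - z)\<bar>) ^ m"
    if "x \<in> {z<..1}" for x
  proof -
    have "\<bar>F 0 x\<bar> = \<bar>G j x\<bar> * (x - z) powr \<sigma> * \<bar>ln (x - z)\<bar> ^ m"
      by (simp add: F_def abs_mult power_abs)
    also have "\<dots> \<le> B * (x - z) powr \<sigma> * (1 + \<bar>ln (x - z)\<bar>) ^ m"
      using that B by (intro mult_mono power_mono) auto
    finally show ?thesis by simp
  qed
  ultimately show ?case using B(1)
    by (intro exI[of _ F] exI[of _ B]) (auto simp: F_def)
next
  case (Suc k)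
  have "bounded (G j ` {z..1})"
    using cont by (intro compact_imp_bounded compact_continuous_image) auto
  then obtain B where B: "B > 0" "\<And>x. x \<in> {z..1} \<Longrightarrow> \<bar>G j x\<bar> \<le> B"
    unfolding bounded_pos by auto
  obtain F1 C1 where F1: "F1 0 = (\<lambda>x. (x - z) powr (\<sigma> - 1) * ln (x - z) ^ m * G j x)" "C1 \<ge> 0"
    "\<forall>i<k. \<forall>x\<in>{z<..<1}. (F1 i has_real_derivative F1 (Suc i) x) (at x)"
    "\<forall>i\<le>k. continuous_on {z<..1} (F1 i)"
    "\<forall>i\<le>k. \<forall>x\<in>{z<..1}.
      \<bar>F1 i x\<bar> \<le> C1 * (x - z) powr (\<sigma> - 1 - real i) * (1 + \<bar>ln (x - z)\<bar>) ^ m"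
    using Suc.IH[of "\<sigma> - 1" m j] by (elim exE conjE) (rule that)
  obtain F2 C2 where F2: "F2 0 = (\<lambda>x. (x - z) powr (\<sigma> - 1) * ln (x - z) ^ (m - 1) * G j x)" "C2 \<ge> 0"
    "\<forall>i<k. \<forall>x\<in>{z<..<1}. (F2 i has_real_derivative F2 (Suc i) x) (at x)"
    "\<forall>i\<le>k. continuous_on {z<..1} (F2 i)"
    "\<forall>i\<le>k. \<forall>x\<in>{z<..1}.
      \<bar>F2 i x\<bar> \<le> C2 * (x - z) powr (\<sigma> - 1 - real i) * (1 + \<bar>ln (x - z)\<bar>) ^ (m - 1)"
    \<comment> \<open>For m = 0 the exponent m - 1 is truncated to 0, which is harmless because this
      family is always multiplied by \<open>real m\<close>.\<close>
    using Suc.IH[of "\<sigma> - 1" "m - 1" j] by (elim exE conjE) (rule that)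
  obtain F3 C3 where F3: "F3 0 = (\<lambda>x. (x - z) powr \<sigma> * ln (x - z) ^ m * G (Suc j) x)" "C3 \<ge> 0"
    "\<forall>i<k. \<forall>x\<in>{z<..<1}. (F3 i has_real_derivative F3 (Suc i) x) (at x)"
    "\<forall>i\<le>k. continuous_on {z<..1} (F3 i)"
    "\<forall>i\<le>k. \<forall>x\<in>{z<..1}.
      \<bar>F3 i x\<bar> \<le> C3 * (x - z) powr (\<sigma> - real i) * (1 + \<bar>ln (x - z)\<bar>) ^ m"
    using Suc.IH[of \<sigma> m "Suc j"] by (elim exE conjE) (rule that)
  define F where "F = case_nat (\<lambda>x. (x - z) powr \<sigma> * ln (x - z) ^ m * G j x)
    (\<lambda>i x. \<sigma> * F1 i x + real m * F2 i x + F3 i x)"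
  have F_0: "F 0 = (\<lambda>x. (x - z) powr \<sigma> * ln (x - z) ^ m * G j x)"
    and F_Suc: "F (Suc i) = (\<lambda>x. \<sigma> * F1 i x + real m * F2 i x + F3 i x)" for i
    by (simp_all add: F_def)
  define C where "C = B + (\<bar>\<sigma>\<bar> * C1 + real m * C2 + 2 * C3)"
  have C: "B \<le> C" "\<bar>\<sigma>\<bar> * C1 + real m * C2 + 2 * C3 \<le> C" "C \<ge> 0"
    using B(1) F1(2) F2(2) F3(2) by (auto simp: C_def)
  have "(F i has_real_derivative F (Suc i) x) (at x)" if i: "i < Suc k" and x: "x \<in> {z<..<1}" for i x
  proof (cases i)
    case 0
    have "((\<lambda>x. (x - z) powr \<sigma> * ln (x - z) ^ m * G j x) has_real_derivative
      ((\<sigma> * (x - z) powr (\<sigma> - 1)) * ln (x - z) ^ m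
        + (real m * ln (x - z) ^ (m - 1) * (1 / (x - z))) * (x - z) powr \<sigma>) * G j x
        + G (Suc j) x * ((x - z) powr \<sigma> * ln (x - z) ^ m)) (at x)"
      using x by (intro DERIV_mult deriv) (auto intro!: derivative_eq_intros)
    also have "(real m * ln (x - z) ^ (m - 1) * (1 / (x - z))) * (x - z) powr \<sigma>
        = real m * ((x - z) powr (\<sigma> - 1) * ln (x - z) ^ (m - 1))"
      using x by (simp add: powr_diff)
    finally show ?thesis
      unfolding 0 F_0 F_Suc F1 F2 F3 by (simp add: algebra_simps)
  next
    case (Suc i')
    have "((\<lambda>x. \<sigma> * F1 i' x + real m * F2 i' x + F3 i' x) has_real_derivative
        \<sigma> * F1 i x + real m * F2 i x + F3 i x) (at x)"
      using i x unfolding Suc by (intro DERIV_add DERIV_cmult F1(3)[rule_format] F2(3)[rule_format] F3(3)[rule_format]) auto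
    then show ?thesis by (simp add: Suc F_Suc)
  qed
  moreover have "continuous_on {z<..1} (F i)" if i: "i \<le> Suc k" for i
  proof (cases i)
    case 0
    then show ?thesis
      unfolding 0 F_0 by (intro continuous_intros continuous_on_subset[OF cont]) auto
  next
    case (Suc i')
    then show ?thesis
      using i unfolding Suc F_Suc by (intro continuous_intros F1(4)[rule_format] F2(4)[rule_format] F3(4)[rule_format]) auto
  qed
  moreover have "\<bar>F i x\<bar> \<le> C * (x - z) powr (\<sigma> - real i) * (1 + \<bar>ln (x - z)\<bar>) ^ m"
    if i: "i \<le> Suc k" and x: "x \<in> {z<..1}" for i x
  proof (cases i)
    case 0
    have "\<bar>F i x\<bar> = \<bar>G j x\<bar> * (x - z) powr \<sigma> * \<bar>ln (x - z)\<bar> ^ m"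
      by (simp add: 0 F_0 abs_mult power_abs)
    also have "\<dots> \<le> C * (x - z) powr \<sigma> * (1 + \<bar>ln (x - z)\<bar>) ^ m"
      using x order_trans[OF B(2) C(1)] C(3) by (intro mult_mono power_mono) auto
    finally show ?thesis by (simp add: 0)
  next
    case (Suc i')
    let ?L = "1 + \<bar>ln (x - z)\<bar>" and ?t = "(x - z) powr (\<sigma> - real i)"
    have i': "i' \<le> k" using i Suc by simp
    have t: "\<sigma> - 1 - real i' = \<sigma> - real i" by (simp add: Suc)
    \<comment> \<open>The family \<open>F3\<close> is better than required by one power of x - z,
      which is at most 2 on this interval.\<close>
    have "(x - z) powr (\<sigma> - real i') = (x - z) * ?t"
      using x by (simp add: powr_mult_base Suc)
    also have "\<dots> \<le> 2 * ?t"
      using x z by (intro mult_right_mono) auto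
    finally have t3: "(x - z) powr (\<sigma> - real i') \<le> 2 * ?t" .
    have "\<bar>real m * F2 i' x\<bar> = real m * \<bar>F2 i' x\<bar>" by (simp add: abs_mult)
    with abs_mult[of \<sigma> "F1 i' x"]
    have "\<bar>F i x\<bar> \<le> \<bar>\<sigma>\<bar> * \<bar>F1 i' x\<bar> + real m * \<bar>F2 i' x\<bar> + \<bar>F3 i' x\<bar>"
      unfolding Suc F_Suc by linarith
    also have "\<dots> \<le> \<bar>\<sigma>\<bar> * (C1 * ?t * ?L ^ m) + real m * (C2 * ?t * ?L ^ m) + C3 * (2 * ?t) * ?L ^ m"
    proof (intro add_mono mult_left_mono)
      show "\<bar>F1 i' x\<bar> \<le> C1 * ?t * ?L ^ m"
        using F1(5)[rule_format, OF i' x] unfolding t .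
      have "\<bar>F2 i' x\<bar> \<le> C2 * ?t * ?L ^ (m - 1)"
        using F2(5)[rule_format, OF i' x] unfolding t .
      also have "\<dots> \<le> C2 * ?t * ?L ^ m"
        using F2(2) by (intro mult_left_mono power_increasing) auto
      finally show "\<bar>F2 i' x\<bar> \<le> C2 * ?t * ?L ^ m" .
      have "\<bar>F3 i' x\<bar> \<le> C3 * (x - z) powr (\<sigma> - real i') * ?L ^ m"
        by (rule F3(5)[rule_format, OF i' x])
      also have "\<dots> \<le> C3 * (2 * ?t) * ?L ^ m"
        using F3(2) t3 by (intro mult_right_mono mult_left_mono) auto
      finally show "\<bar>F3 i' x\<bar> \<le> C3 * (2 * ?t) * ?L ^ m" .
    qed auto
    also have "\<dots> = (\<bar>\<sigma>\<bar> * C1 + real m * C2 + 2 * C3) * ?t * ?L ^ m"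
      by (simp add: algebra_simps)
    also have "\<dots> \<le> C * ?t * ?L ^ m"
      using C(2) by (intro mult_right_mono) auto
    finally show ?thesis .
  qed
  ultimately show ?case
    using C(3) F_0 by (intro exI[of _ F] exI[of _ C] conjI) (assumption | blast)+
qed

text \<open>With the sign convention U(k+1)' = - U k the integrals of U k F k and U(k+1) F(k+1)
  differ only by a boundary term, with no alternating signs. \<open>U 0\<close> may be singular at
  an end of the interval: the integral then exists by the fundamental theorem.\<close>

lemma iterated_integration_by_parts_bound:
  fixes U F :: "nat \<Rightarrow> real \<Rightarrow> real"
  assumes "a \<le> b"
    and "\<And>k x. k < K \<Longrightarrow> x \<in> {a<..<b} \<Longrightarrow> (U (Suc k) has_real_derivative - U k x) (at x)"
    and "\<And>k x. k < K \<Longrightarrow> x \<in> {a<..<b} \<Longrightarrow> (F k has_real_derivative F (Suc k) x) (at x)"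
    and "\<And>k. k < K \<Longrightarrow> continuous_on {a..b} (U (Suc k))"
    and "\<And>k. k \<le> K \<Longrightarrow> continuous_on {a..b} (F k)"
  shows "\<bar>integral {a..b} (\<lambda>x. U 0 x * F 0 x)\<bar> \<le>
    (\<Sum>k<K. \<bar>U (Suc k) a * F k a\<bar> + \<bar>U (Suc k) b * F k b\<bar>) + \<bar>integral {a..b} (\<lambda>x. U K x * F K x)\<bar>"
  using assms
proof (induction K)
  case (Suc K)
  let ?B = "U (Suc K) b * F K b - U (Suc K) a * F K a"
  have "((\<lambda>x. - U K x * F K x + U (Suc K) x * F (Suc K) x) has_integral ?B) {a..b}"
  proof (rule fundamental_theorem_of_calculus_interior[OF \<open>a \<le> b\<close>])
    show "continuous_on {a..b} (\<lambda>x. U (Suc K) x * F K x)"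
      using Suc.prems by (intro continuous_intros) auto
    fix x assume x: "x \<in> {a<..<b}"
    show "((\<lambda>x. U (Suc K) x * F K x) has_vector_derivative
        - U K x * F K x + U (Suc K) x * F (Suc K) x) (at x)"
      using DERIV_mult[OF Suc.prems(2)[of K x] Suc.prems(3)[of K x]] x
      unfolding has_real_derivative_iff_has_vector_derivative[symmetric]
      by (simp add: algebra_simps)
  qed
  from has_integral_neg[OF this] have "((\<lambda>x. U K x * F K x - U (Suc K) x * F (Suc K) x)
      has_integral - ?B) {a..b}"
    by simp
  moreover have "(\<lambda>x. U (Suc K) x * F (Suc K) x) integrable_on {a..b}"
    using Suc.prems by (intro integrable_continuous_real continuous_intros) auto
  then have "((\<lambda>x. U (Suc K) x * F (Suc K) x)
      has_integral integral {a..b} (\<lambda>x. U (Suc K) x * F (Suc K) x)) {a..b}"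
    by (rule integrable_integral)
  ultimately have "((\<lambda>x. U K x * F K x - U (Suc K) x * F (Suc K) x + U (Suc K) x * F (Suc K) x)
      has_integral - ?B + integral {a..b} (\<lambda>x. U (Suc K) x * F (Suc K) x)) {a..b}"
    by (rule has_integral_add)
  then have "((\<lambda>x. U K x * F K x)
      has_integral integral {a..b} (\<lambda>x. U (Suc K) x * F (Suc K) x) - ?B) {a..b}"
    by (simp add: algebra_simps)
  then have "integral {a..b} (\<lambda>x. U K x * F K x)
      = integral {a..b} (\<lambda>x. U (Suc K) x * F (Suc K) x) - ?B"
    by (rule integral_unique)
  moreover have "\<bar>integral {a..b} (\<lambda>x. U 0 x * F 0 x)\<bar> \<le>
    (\<Sum>k<K. \<bar>U (Suc k) a * F k a\<bar> + \<bar>U (Suc k) b * F k b\<bar>) + \<bar>integral {a..b} (\<lambda>x. U K x * F K x)\<bar>"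
    using Suc.prems by (intro Suc.IH) auto
  ultimately show ?case unfolding sum.lessThan_Suc by linarith
qed simp

text \<open>With a = \<sigma>/m, the inequality ln y \<le> y - 1 at y = t^(-a) gives 1 + |ln t|
  \<le> t^(-a) (1 + 1/a); the m-th power costs exactly t^(-\<sigma>).\<close>

lemma powr_log_power_le:
  fixes t \<sigma> :: real
  assumes "0 < t" "t \<le> 1" "\<sigma> > 0" "m \<ge> 1"
  shows "t powr \<sigma> * (1 + \<bar>ln t\<bar>) ^ m \<le> (1 + real m / \<sigma>) ^ m"
proof -
  define a where "a = \<sigma> / real m"
  have a: "a > 0" using assms by (simp add: a_def)
  have "ln (t powr - a) \<le> t powr - a - 1"
    using assms by (intro ln_le_minus_one) auto
  then have "a * \<bar>ln t\<bar> \<le> t powr - a"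
    using assms by (simp add: ln_powr)
  then have "\<bar>ln t\<bar> \<le> t powr - a / a"
    using a by (simp add: field_simps)
  moreover have "1 \<le> t powr - a"
    using powr_mono2'[of "-a" t 1] a assms by simp
  ultimately have "1 + \<bar>ln t\<bar> \<le> t powr - a * (1 + 1 / a)"
    by (simp add: algebra_simps)
  then have "t powr \<sigma> * (1 + \<bar>ln t\<bar>) ^ m \<le> t powr \<sigma> * (t powr - a * (1 + 1 / a)) ^ m"
    by (intro mult_left_mono power_mono) auto
  also have "\<dots> = t powr \<sigma> * t powr (- a * real m) * (1 + 1 / a) ^ m"
    using assms by (simp add: power_mult_distrib powr_power mult.commute)
  also have "t powr \<sigma> * t powr (- a * real m) = 1"
    using assms by (simp add: a_def flip: powr_add)
  finally show ?thesis by (simp add: a_def)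
qed

text \<open>Rescale t = \<tau>/n. As n \<ge> 3 gives ln n \<ge> 1, |ln t| is at most ln n (1 + |ln
  \<tau>|), and the remaining function of \<tau> is bounded on (0, 1]. At t = 0 the left side is 0
  by \<open>0 powr s = 0\<close>.\<close>

lemma powr_log_power_near_zero:
  fixes t s :: real and n m :: nat
  assumes "0 \<le> t" "t \<le> 1 / real n" "n \<ge> 3" "s > 0" "m \<ge> 1"
  shows "\<bar>t powr s * ln t ^ m\<bar> \<le> (1 + real m / s) ^ m * (ln (real n) ^ m * real n powr - s)"
proof (cases "t = 0")
  case False
  define \<tau> where "\<tau> = real n * t"
  have n: "real n > 0" and \<tau>: "0 < \<tau>" "\<tau> \<le> 1" and t: "t = \<tau> / real n"
    using assms False by (auto simp: \<tau>_def field_simps)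
  have "exp 1 \<le> real n" using exp_le assms by linarith
  then have l: "ln (real n) \<ge> 1" using n by (simp add: ln_ge_iff)
  have tp: "t powr s = \<tau> powr s * real n powr - s"
    using \<tau> n by (simp add: t powr_divide powr_minus_divide)
  have "\<bar>ln t\<bar> \<le> ln (real n) + \<bar>ln \<tau>\<bar>"
    using \<tau> n l by (simp add: t ln_div)
  also have "\<dots> \<le> ln (real n) * (1 + \<bar>ln \<tau>\<bar>)"
    using mult_right_mono[OF l, of "\<bar>ln \<tau>\<bar>"] by (simp add: algebra_simps)
  finally have "t powr s * \<bar>ln t\<bar> ^ m \<le> t powr s * (ln (real n) * (1 + \<bar>ln \<tau>\<bar>)) ^ m"
    by (intro mult_left_mono power_mono) auto
  also have "\<dots> = ln (real n) ^ m * real n powr - s * (\<tau> powr s * (1 + \<bar>ln \<tau>\<bar>) ^ m)"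
    unfolding tp by (simp add: power_mult_distrib mult_ac)
  also have "\<dots> \<le> ln (real n) ^ m * real n powr - s * (1 + real m / s) ^ m"
    using l \<tau> assms by (intro mult_left_mono powr_log_power_le) auto
  finally show ?thesis by (simp add: abs_mult power_abs mult_ac)
next
  case True
  then show ?thesis using assms by (auto intro!: mult_nonneg_nonneg)
qed

text \<open>Split at b = z + 1/n. On [z, b] the length 1/n meets an integrand of order ln^\<mu>(n)
  n^(-s). On [b, 1] integrate by parts K times: each boundary term at b has n^(-k-1) n^(k-s), those
  at 1 vanish, and K > s + 1 makes the last integral be governed by its lower limit. The constant is
  fixed before U and A, so it serves all solutions simultaneously.\<close>

lemma powr_log_power_mult_integral_bound:
  fixes U :: "nat \<Rightarrow> real \<Rightarrow> real" and G :: "nat \<Rightarrow> real \<Rightarrow> real" and \<mu> K :: nat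
  assumes z: "-1 < z" "z < r" "r < 1" and s: "s > 0" and \<mu>: "\<mu> \<ge> 1" and K: "real K > s + 1"
    and G: "\<And>j x. x \<in> {z<..<1} \<Longrightarrow> (G j has_real_derivative G (Suc j) x) (at x)"
    and contG: "\<And>j. continuous_on {z..1} (G j)"
  shows "\<exists>C>0. \<forall>\<^sub>F n in sequentially. \<forall>U A. A \<ge> 0 \<longrightarrow>
    (\<forall>k<K. \<forall>x\<in>{-1<..<1}. (U (Suc k) has_real_derivative - U k x) (at x)) \<longrightarrow>
    (\<forall>k<K. continuous_on {-1..1} (U (Suc k)) \<and> U (Suc k) 1 = 0) \<longrightarrow>
    (\<forall>k\<le>K. \<forall>x\<in>{z..r}. \<bar>U k x\<bar> \<le> A * real n powr - real k) \<longrightarrow>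
    (\<forall>x\<in>{-1..1}. \<bar>U K x\<bar> \<le> A * real n powr - real K) \<longrightarrow>
    (\<lambda>x. U 0 x * ((x - z) powr s * ln (x - z) ^ \<mu> * G 0 x)) integrable_on {z..1} \<longrightarrow>
    \<bar>integral {z..1} (\<lambda>x. U 0 x * ((x - z) powr s * ln (x - z) ^ \<mu> * G 0 x))\<bar>
      \<le> C * A * (ln (real n) ^ \<mu> * real n powr (-1 - s))"
proof -
  have "bounded (G 0 ` {z..1})"
    using contG by (intro compact_imp_bounded compact_continuous_image) auto
  then obtain B where B: "B > 0" "\<And>x. x \<in> {z..1} \<Longrightarrow> \<bar>G 0 x\<bar> \<le> B"
    unfolding bounded_pos by auto
  obtain F C where F0: "F 0 = (\<lambda>x. (x - z) powr s * ln (x - z) ^ \<mu> * G 0 x)" and C: "C \<ge> 0"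
    and F_deriv: "\<forall>i<K. \<forall>x\<in>{z<..<1}. (F i has_real_derivative F (Suc i) x) (at x)"
    and F_cont: "\<forall>i\<le>K. continuous_on {z<..1} (F i)"
    and F_bound: "\<forall>i\<le>K. \<forall>x\<in>{z<..1}.
      \<bar>F i x\<bar> \<le> C * (x - z) powr (s - real i) * (1 + \<bar>ln (x - z)\<bar>) ^ \<mu>"
    by (rule powr_log_power_derivatives[of z G s \<mu> 0 K, THEN exE])
       (use z in simp, erule G, rule contG, elim exE conjE, rule that)
  define D where "D = (1 + real \<mu> / s) ^ \<mu> * B"
  have D: "D > 0" using s B by (auto simp: D_def intro!: mult_pos_pos zero_less_power add_pos_nonneg)
  \<comment> \<open>The three summands account for the piece near z, the K boundary terms at b, and
    the integral left after the last integration by parts.\<close>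
  define C1 where "C1 = D + real K * (C * 2 ^ \<mu>) + C * 2 ^ \<mu> / (real K - s - 1)"
  have C1: "C1 > 0" using D C K unfolding C1_def by (intro add_pos_nonneg) auto
  \<comment> \<open>This ensures ln n \<ge> 1 and b \<le> r, so that the bounds on every
    \<open>U k\<close> are available throughout [z, b].\<close>
  define N where "N = max 3 (nat \<lceil>1 / (r - z)\<rceil>)"
  have "\<bar>integral {z..1} (\<lambda>x. U 0 x * F 0 x)\<bar> \<le> C1 * A * (ln (real n) ^ \<mu> * real n powr (-1 - s))"
    if n: "n \<ge> N" and A: "A \<ge> 0"
      and U_deriv: "\<forall>k<K. \<forall>x\<in>{-1<..<1}. (U (Suc k) has_real_derivative - U k x) (at x)"
      and U_cont: "\<forall>k<K. continuous_on {-1..1} (U (Suc k)) \<and> U (Suc k) 1 = 0"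
      and U_bound: "\<forall>k\<le>K. \<forall>x\<in>{z..r}. \<bar>U k x\<bar> \<le> A * real n powr - real k"
      and UK_bound: "\<forall>x\<in>{-1..1}. \<bar>U K x\<bar> \<le> A * real n powr - real K"
      and int: "(\<lambda>x. U 0 x * F 0 x) integrable_on {z..1}" for n A and U :: "nat \<Rightarrow> real \<Rightarrow> real"
  proof -
    have n3: "n \<ge> 3" and "real n \<ge> 1 / (r - z)" using n unfolding N_def by linarith+
    define b where "b = z + 1 / real n"
    have n0: "real n > 0" using n3 by simp
    have b: "z < b" "b \<le> r"
      using \<open>real n \<ge> 1 / (r - z)\<close> n0 z by (auto simp: b_def field_simps)
    then have "b < 1" using z by simp
    note b = b this
    have "exp 1 \<le> real n" using exp_le n3 by linarith
    then have l: "ln (real n) \<ge> 1" using n0 by (simp add: ln_ge_iff)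
    let ?R = "ln (real n) ^ \<mu> * real n powr (-1 - s)"
    \<comment> \<open>On [b, 1] one has 1/n \<le> x - z \<le> 2 \<le> n, so the logarithm is at most
      ln n in absolute value.\<close>
    have log: "(1 + \<bar>ln (x - z)\<bar>) ^ \<mu> \<le> 2 ^ \<mu> * ln (real n) ^ \<mu>" if "x \<in> {b..1}" for x
    proof -
      have x: "x - z > 0" "1 / real n \<le> x - z" "x - z \<le> real n"
        using that z n3 b(1) by (simp, simp add: b_def, simp)
      have "ln (1 / real n) \<le> ln (x - z)" "ln (x - z) \<le> ln (real n)"
        using x n0 by (subst ln_le_cancel_iff; simp)+
      then have "\<bar>ln (x - z)\<bar> \<le> ln (real n)"
        using n0 by (simp add: ln_div abs_le_iff)
      then have "1 + \<bar>ln (x - z)\<bar> \<le> 2 * ln (real n)" using l by simp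
      then have "(1 + \<bar>ln (x - z)\<bar>) ^ \<mu> \<le> (2 * ln (real n)) ^ \<mu>" by (intro power_mono) auto
      then show ?thesis by (simp add: power_mult_distrib)
    qed
    have Fb: "\<bar>F i x\<bar> \<le> C * 2 ^ \<mu> * ln (real n) ^ \<mu> * (x - z) powr (s - real i)"
      if "i \<le> K" "x \<in> {b..1}" for i x
    proof -
      have "\<bar>F i x\<bar> \<le> C * (x - z) powr (s - real i) * (1 + \<bar>ln (x - z)\<bar>) ^ \<mu>"
        using F_bound that b by auto
      also have "\<dots> \<le> C * (x - z) powr (s - real i) * (2 ^ \<mu> * ln (real n) ^ \<mu>)"
        using C by (intro mult_left_mono log that) auto
      finally show ?thesis by (simp add: mult_ac)
    qed
    have near: "\<bar>integral {z..b} (\<lambda>x. U 0 x * F 0 x)\<bar> \<le> D * A * ?R"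
    proof -
      let ?M = "A * ((1 + real \<mu> / s) ^ \<mu> * (ln (real n) ^ \<mu> * real n powr - s) * B)"
      have "norm (integral {z..b} (\<lambda>x. U 0 x * F 0 x)) \<le> integral {z..b} (\<lambda>x. ?M)"
      proof (rule integral_norm_bound_integral)
        show "(\<lambda>x. U 0 x * F 0 x) integrable_on {z..b}"
          using int by (rule integrable_subinterval_real) (use b in auto)
        fix x assume x: "x \<in> {z..b}"
        have "\<bar>U 0 x\<bar> \<le> A * real n powr - real 0"
          using U_bound x b by auto
        then have U0: "\<bar>U 0 x\<bar> \<le> A" using n0 by simp
        have "\<bar>(x - z) powr s * ln (x - z) ^ \<mu>\<bar>
            \<le> (1 + real \<mu> / s) ^ \<mu> * (ln (real n) ^ \<mu> * real n powr - s)"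
          using x n3 s \<mu> by (intro powr_log_power_near_zero) (auto simp: b_def)
        then have "\<bar>U 0 x\<bar> * (\<bar>(x - z) powr s * ln (x - z) ^ \<mu>\<bar> * \<bar>G 0 x\<bar>) \<le> ?M"
          using x b U0 l s A by (intro mult_mono B) (auto intro!: mult_nonneg_nonneg)
        then show "norm (U 0 x * F 0 x) \<le> ?M"
          by (simp add: F0 abs_mult mult_ac)
      qed (rule integrable_const_ivl)
      also have "integral {z..b} (\<lambda>x. ?M) = ?M * (1 / real n)"
        using b by (simp add: b_def)
      also have "\<dots> = D * A * ?R"
        using n0 by (simp add: D_def powr_diff powr_minus field_simps)
      finally show ?thesis by simp
    qed
    have far: "\<bar>integral {b..1} (\<lambda>x. U 0 x * F 0 x)\<bar>
      \<le> (real K * (C * 2 ^ \<mu>) + C * 2 ^ \<mu> / (real K - s - 1)) * A * ?R"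
    proof -
      have bz: "(b - z) powr e = real n powr - e" for e
        using n0 by (simp add: b_def powr_divide powr_minus_divide)
      have "\<bar>integral {b..1} (\<lambda>x. U 0 x * F 0 x)\<bar> \<le>
          (\<Sum>k<K. \<bar>U (Suc k) b * F k b\<bar> + \<bar>U (Suc k) 1 * F k 1\<bar>) + \<bar>integral {b..1} (\<lambda>x. U K x * F K x)\<bar>"
        using U_deriv F_deriv U_cont F_cont z b
        by (intro iterated_integration_by_parts_bound)
           (auto intro: continuous_on_subset)
      also have "(\<Sum>k<K. \<bar>U (Suc k) b * F k b\<bar> + \<bar>U (Suc k) 1 * F k 1\<bar>)
          \<le> (\<Sum>k<K. A * (C * 2 ^ \<mu>) * ?R)"
      proof (rule sum_mono)
        fix k assume k: "k \<in> {..<K}"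
        have "\<bar>U (Suc k) b\<bar> \<le> A * real n powr - real (Suc k)"
          using U_bound k b by (auto simp del: of_nat_Suc)
        then have "\<bar>U (Suc k) b * F k b\<bar> \<le> (A * real n powr - real (Suc k)) *
            (C * 2 ^ \<mu> * ln (real n) ^ \<mu> * (b - z) powr (s - real k))"
          unfolding abs_mult using Fb[of k b] k b A
          by (intro mult_mono) (auto intro!: mult_nonneg_nonneg)
        also have "\<dots> = A * (C * 2 ^ \<mu>) * (ln (real n) ^ \<mu> *
            (real n powr - real (Suc k) * real n powr (- (s - real k))))"
          by (simp add: bz mult_ac)
        also have "real n powr - real (Suc k) * real n powr (- (s - real k)) = real n powr (-1 - s)"
          by (simp flip: powr_add)
        finally show "\<bar>U (Suc k) b * F k b\<bar> + \<bar>U (Suc k) 1 * F k 1\<bar> \<le> A * (C * 2 ^ \<mu>) * ?R"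
          using U_cont k by simp
      qed
      also have "\<bar>integral {b..1} (\<lambda>x. U K x * F K x)\<bar> \<le> C * 2 ^ \<mu> / (real K - s - 1) * A * ?R"
      proof -
        let ?q = "s - real K"
        let ?c = "A * real n powr - real K * (C * 2 ^ \<mu> * ln (real n) ^ \<mu>)"
        have q: "?q + 1 < 0" using K by simp
        have hi: "((\<lambda>x. ?c * (x - z) powr ?q) has_integral
            ?c * ((1 - z) powr (?q + 1) / (?q + 1) - (b - z) powr (?q + 1) / (?q + 1))) {b..1}"
        proof (intro has_integral_mult_right fundamental_theorem_of_calculus)
          fix x assume "x \<in> {b..1}"
          then have "((\<lambda>x. (x - z) powr (?q + 1) / (?q + 1)) has_real_derivative (x - z) powr ?q) (at x)"
            using b q by (auto intro!: derivative_eq_intros)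
          then show "((\<lambda>x. (x - z) powr (?q + 1) / (?q + 1)) has_vector_derivative (x - z) powr ?q)
              (at x within {b..1})"
            by (simp add: has_real_derivative_iff_has_vector_derivative has_vector_derivative_at_within)
        qed (use b in simp)
        have "norm (integral {b..1} (\<lambda>x. U K x * F K x)) \<le> integral {b..1} (\<lambda>x. ?c * (x - z) powr ?q)"
        proof (rule integral_norm_bound_integral)
          obtain K' where K': "K = Suc K'" using K s by (cases K) auto
          have "continuous_on {b..1} (U K)"
            using U_cont z b unfolding K' by (auto intro: continuous_on_subset)
          moreover have "continuous_on {b..1} (F K)"
            using F_cont b by (auto intro: continuous_on_subset)
          ultimately show "(\<lambda>x. U K x * F K x) integrable_on {b..1}"
            by (intro integrable_continuous_real continuous_intros)
          show "(\<lambda>x. ?c * (x - z) powr ?q) integrable_on {b..1}"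
            using hi by blast
          fix x assume x: "x \<in> {b..1}"
          have "\<bar>U K x\<bar> * \<bar>F K x\<bar> \<le> (A * real n powr - real K) *
              (C * 2 ^ \<mu> * ln (real n) ^ \<mu> * (x - z) powr ?q)"
            using UK_bound Fb[of K x] x z b A by (intro mult_mono) auto
          then show "norm (U K x * F K x) \<le> ?c * (x - z) powr ?q"
            by (simp add: abs_mult mult_ac)
        qed
        also have "\<dots> = ?c * ((1 - z) powr (?q + 1) / (?q + 1) - (b - z) powr (?q + 1) / (?q + 1))"
          by (rule integral_unique[OF hi])
        also have "\<dots> \<le> ?c * ((b - z) powr (?q + 1) / (real K - s - 1))"
        proof (rule mult_left_mono)
          have "(1 - z) powr (?q + 1) / (?q + 1) \<le> 0"
            using q by (intro divide_nonneg_nonpos) auto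
          moreover have "- ((b - z) powr (?q + 1) / (?q + 1)) = (b - z) powr (?q + 1) / (real K - s - 1)"
            by (simp add: minus_divide_right)
          ultimately show "(1 - z) powr (?q + 1) / (?q + 1) - (b - z) powr (?q + 1) / (?q + 1)
              \<le> (b - z) powr (?q + 1) / (real K - s - 1)"
            by linarith
          show "0 \<le> ?c" using A C l by auto
        qed
        also have "\<dots> = C * 2 ^ \<mu> / (real K - s - 1) * A * (ln (real n) ^ \<mu> *
            (real n powr - real K * real n powr (- (?q + 1))))"
          by (simp add: bz mult_ac)
        also have "real n powr - real K * real n powr (- (?q + 1)) = real n powr (-1 - s)"
          unfolding powr_add[symmetric] by (rule arg_cong[where f = "(powr) (real n)"]) simp
        finally show ?thesis by simp
      qed
      finally show ?thesis by (simp add: algebra_simps)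
    qed
    have "integral {z..1} (\<lambda>x. U 0 x * F 0 x)
        = integral {z..b} (\<lambda>x. U 0 x * F 0 x) + integral {b..1} (\<lambda>x. U 0 x * F 0 x)"
      using Henstock_Kurzweil_Integration.integral_combine[OF _ _ int, of b] b by simp
    then have "\<bar>integral {z..1} (\<lambda>x. U 0 x * F 0 x)\<bar> \<le>
        D * A * ?R + (real K * (C * 2 ^ \<mu>) + C * 2 ^ \<mu> / (real K - s - 1)) * A * ?R"
      using near far by linarith
    then show ?thesis by (simp add: C1_def algebra_simps)
  qed
  then show ?thesis
    unfolding F0 using C1
    by (intro exI[of _ C1] conjI eventually_sequentiallyI[of N]) blast+
qed

subsection \<open>Integrals of solutions against the singular function\<close>

text \<open>Only the origin matters. One factor |t|^(s/2) absorbs the logarithms and the other tends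
  to 0, which is also the value there since \<open>0 powr s = 0\<close>.\<close>

lemma continuous_on_abs_powr_log_power:
  fixes z s :: real
  assumes "s > 0" "m \<ge> 1"
  shows "continuous_on UNIV (\<lambda>x. \<bar>x - z\<bar> powr s * ln \<bar>x - z\<bar> ^ m)"
proof -
  have "isCont (\<lambda>t. \<bar>t\<bar> powr s * ln \<bar>t\<bar> ^ m) t" for t :: real
  proof (cases "t = 0")
    case True
    define C where "C = (1 + real m / (s / 2)) ^ m"
    have "((\<lambda>t. \<bar>t\<bar> powr s * ln \<bar>t\<bar> ^ m) \<longlongrightarrow> 0) (at 0)"
    proof (rule Lim_null_comparison)
      have "norm (\<bar>t\<bar> powr s * ln \<bar>t\<bar> ^ m) \<le> C * \<bar>t\<bar> powr (s / 2)"
        if t: "t \<noteq> 0" "dist t 0 < 1" for t :: real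
      proof -
        have "\<bar>t\<bar> powr s = \<bar>t\<bar> powr (s / 2) * \<bar>t\<bar> powr (s / 2)"
          by (simp flip: powr_add)
        then have "norm (\<bar>t\<bar> powr s * ln \<bar>t\<bar> ^ m)
            = \<bar>t\<bar> powr (s / 2) * (\<bar>t\<bar> powr (s / 2) * \<bar>ln \<bar>t\<bar>\<bar> ^ m)"
          by (simp add: abs_mult power_abs)
        also have "\<dots> \<le> \<bar>t\<bar> powr (s / 2) * (\<bar>t\<bar> powr (s / 2) * (1 + \<bar>ln \<bar>t\<bar>\<bar>) ^ m)"
          by (intro mult_left_mono power_mono) auto
        also have "\<dots> \<le> \<bar>t\<bar> powr (s / 2) * C"
          unfolding C_def using t assms by (intro mult_left_mono powr_log_power_le) auto
        finally show ?thesis by (simp add: mult.commute)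
      qed
      then show "\<forall>\<^sub>F t in at 0. norm (\<bar>t\<bar> powr s * ln \<bar>t\<bar> ^ m) \<le> C * \<bar>t\<bar> powr (s / 2)"
        unfolding eventually_at by (intro exI[of _ 1]) auto
      have "((\<lambda>t. C * \<bar>t\<bar> powr (s / 2)) \<longlongrightarrow> C * \<bar>0\<bar> powr (s / 2)) (at 0)"
        using assms by (intro tendsto_intros) auto
      then show "((\<lambda>t. C * \<bar>t\<bar> powr (s / 2)) \<longlongrightarrow> 0) (at 0)" by simp
    qed
    then show ?thesis using assms by (simp add: isCont_def True)
  next
    case False
    then show ?thesis by (intro continuous_intros) auto
  qed
  then have "continuous_on UNIV (\<lambda>t. \<bar>t\<bar> powr s * ln \<bar>t\<bar> ^ m)"
    by (simp add: continuous_on_eq_continuous_at)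
  from continuous_on_compose2[OF this, of UNIV "\<lambda>x. x - z"] show ?thesis
    by (simp add: continuous_intros)
qed

text \<open>The \<open>k\<close>-th derivative solves the equation for \<open>\<nu> + k\<close> with this eigenvalue, which is
  \<open>(n - k) (n + k + 2 \<nu>)\<close> when \<open>M = n (n + 2 \<nu>)\<close>.\<close>

definition deriv_eigenvalue :: "real \<Rightarrow> real \<Rightarrow> nat \<Rightarrow> real" where
  "deriv_eigenvalue \<nu> M k = M - real k * (2 * \<nu> + real k)"

section \<open>Higher derivatives of solutions: equations, norms and eigenvalues\<close>

lemma gegenbauer_ode_higher_pderiv:
  assumes "gegenbauer_ode \<nu> M p"
  shows "gegenbauer_ode (\<nu> + real k) (deriv_eigenvalue \<nu> M k) ((pderiv ^^ k) p)"
proof (induction k)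
  case 0
  then show ?case using assms by (simp add: deriv_eigenvalue_def)
next
  case (Suc k)
  have "\<nu> + real (Suc k) = \<nu> + real k + 1"
    "deriv_eigenvalue \<nu> M (Suc k) = deriv_eigenvalue \<nu> M k - (2 * (\<nu> + real k) + 1)"
    by (simp_all add: deriv_eigenvalue_def algebra_simps)
  with gegenbauer_ode_pderiv[OF Suc] show ?case by (simp only: funpow.simps o_apply)
qed

lemma weighted_inner_higher_pderiv:
  assumes "\<nu> > -1/2" "gegenbauer_ode \<nu> M p"
  shows "weighted_inner (\<nu> + real k) ((pderiv ^^ k) p) ((pderiv ^^ k) p)
    = (\<Prod>j<k. deriv_eigenvalue \<nu> M j) * weighted_inner \<nu> p p"
proof (induction k)
  case (Suc k)
  have "\<nu> + real (Suc k) = \<nu> + real k + 1" by simp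
  moreover have "\<nu> + real k > -1/2" using assms(1) by simp
  note weighted_inner_pderiv[OF this gegenbauer_ode_higher_pderiv[OF assms(2)]]
  ultimately show ?case
    unfolding funpow.simps o_apply prod.lessThan_Suc by (simp only: Suc mult_ac)
qed simp

text \<open>The eigenvalue is n^2 + 2n\<nu> - k(2\<nu> + k). The first size condition keeps
  |2n\<nu>| below n^2/4, and the second does the same for the last term.\<close>

lemma deriv_eigenvalue_ge:
  assumes "real n \<ge> 8 * \<bar>\<nu>\<bar>" "real n \<ge> 4 * (real K * (2 * \<bar>\<nu>\<bar> + real K)) + 1" "k \<le> K"
  shows "deriv_eigenvalue \<nu> (real n * (real n + 2 * \<nu>)) k \<ge> (real n)\<^sup>2 / 2"
proof -
  have "real n * (2 * \<bar>\<nu>\<bar>) \<le> real n * (real n / 4)"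
    using assms(1) by (intro mult_left_mono) auto
  moreover have "real n * (2 * \<nu>) \<ge> - (real n * (2 * \<bar>\<nu>\<bar>))"
    using mult_left_mono[of "- (2 * \<bar>\<nu>\<bar>)" "2 * \<nu>" "real n"] by simp
  moreover have "real k * (2 * \<nu> + real k) \<le> real K * (2 * \<bar>\<nu>\<bar> + real K)"
  proof -
    have "real k * (2 * \<nu> + real k) \<le> real k * (2 * \<bar>\<nu>\<bar> + real k)"
      by (intro mult_left_mono) auto
    also have "\<dots> \<le> real K * (2 * \<bar>\<nu>\<bar> + real K)"
      using assms(3) by (intro mult_mono) auto
    finally show ?thesis .
  qed
  moreover have "real n \<ge> 1"
    using assms(2) by (rule order_trans[rotated]) simp
  then have "real n \<le> real n * real n"
    using mult_left_mono[of 1 "real n" "real n"] by simp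
  ultimately show ?thesis
    using assms(2) by (simp add: deriv_eigenvalue_def power2_eq_square algebra_simps)
qed

lemma eventually_deriv_eigenvalue_ge:
  "\<forall>\<^sub>F n in sequentially. n \<ge> 1 \<and>
    (\<forall>k\<le>K. deriv_eigenvalue \<nu> (real n * (real n + 2 * \<nu>)) k \<ge> (real n)\<^sup>2 / 2)"
proof -
  have "\<forall>\<^sub>F n in sequentially. real n \<ge> x" for x
    using eventually_ge_at_top[of "nat \<lceil>x\<rceil>"] by eventually_elim linarith
  note this[of "8 * \<bar>\<nu>\<bar>"] this[of "4 * (real K * (2 * \<bar>\<nu>\<bar> + real K)) + 1"] eventually_ge_at_top[of 1]
  then show ?thesis
    by eventually_elim (use deriv_eigenvalue_ge in blast)
qed

text \<open>\<open>U (k + 1)\<close> is an antiderivative of \<open>- U k\<close> vanishing at \<open>\<plusminus>1\<close>, and each such integration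
  gains a factor \<open>1/n\<close>.\<close>

lemma normalised_pderiv_bounds:
  assumes \<nu>: "\<nu> > -1/2" and r: "r < 1" and K: "K \<ge> 2"
  defines "U \<equiv> \<lambda>M p k x. weight (\<nu> + real k) x * poly ((pderiv ^^ k) p) x / (\<Prod>j<k. deriv_eigenvalue \<nu> M j)"
  shows "\<exists>C>0. \<forall>n M p. n \<ge> 1 \<longrightarrow> (\<forall>k\<le>K. deriv_eigenvalue \<nu> M k \<ge> (real n)\<^sup>2 / 2) \<longrightarrow>
    gegenbauer_ode \<nu> M p \<longrightarrow>
    (\<forall>k\<le>K. \<forall>x\<in>{-r..r}. \<bar>U M p k x\<bar> \<le> C * sqrt (weighted_inner \<nu> p p) * real n powr - real k) \<and>
    (\<forall>x\<in>{-1..1}. \<bar>U M p K x\<bar> \<le> C * sqrt (weighted_inner \<nu> p p) * real n powr - real K)"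
proof -
  have "\<forall>k. \<exists>C>0. \<forall>M p x. M > 0 \<longrightarrow> gegenbauer_ode (\<nu> + real k) M p \<longrightarrow> x \<in> {-r..r} \<longrightarrow>
      \<bar>weight (\<nu> + real k) x * poly p x\<bar> \<le> C * sqrt (weighted_inner (\<nu> + real k) p p)"
    using \<nu> r by (intro allI gegenbauer_ode_interior_bound) (auto intro: less_le_trans)
  then obtain Ci where Ci_pos: "\<And>k. Ci k > 0" and
    Ci: "\<And>k M p x. M > 0 \<Longrightarrow> gegenbauer_ode (\<nu> + real k) M p \<Longrightarrow> x \<in> {-r..r} \<Longrightarrow>
      \<bar>weight (\<nu> + real k) x * poly p x\<bar> \<le> Ci k * sqrt (weighted_inner (\<nu> + real k) p p)"
    by metis
  \<comment> \<open>The bound up to the endpoints controls the derivative of a solution with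
    nonnegative parameter. It is applied to the K'-th derivative: K \<ge> 2 gives K' \<ge> 1, hence
    \<nu> + K' \<ge> 0.\<close>
  obtain K' where K': "K = Suc K'" using K by (cases K) auto
  have \<nu>K': "\<nu> + real K' \<ge> 0" and \<nu>K: "\<nu> + real K = \<nu> + real K' + 1"
    using K \<nu> by (auto simp: K')
  obtain Cg where Cg_pos: "Cg > 0" and
    Cg: "\<And>M p x. M > 0 \<Longrightarrow> gegenbauer_ode (\<nu> + real K') M p \<Longrightarrow> x \<in> {-1..1} \<Longrightarrow>
      \<bar>weight (\<nu> + real K) x * poly (pderiv p) x\<bar>
        \<le> Cg * sqrt (weighted_inner (\<nu> + real K) (pderiv p) (pderiv p))"
    using gegenbauer_ode_pderiv_bound[OF \<nu>K'] unfolding \<nu>K by auto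
  define C where "C = (\<Sum>k\<le>K. Ci k * sqrt 2 ^ k) + Cg * sqrt 2 ^ K"
  have Ci_nonneg: "Ci k * sqrt 2 ^ k \<ge> 0" for k
    using less_imp_le[OF Ci_pos] by simp
  have Ci_le: "Ci k * sqrt 2 ^ k \<le> C" if "k \<le> K" for k
    using member_le_sum[of k "{..K}" "\<lambda>k. Ci k * sqrt 2 ^ k", OF _ Ci_nonneg] that Cg_pos
    unfolding C_def by (auto intro!: add_increasing2)
  have Cg_le: "Cg * sqrt 2 ^ K \<le> C"
    unfolding C_def
    by (auto intro!: add_increasing sum_nonneg mult_nonneg_nonneg less_imp_le[OF Ci_pos])
  have C_pos: "C > 0"
    by (rule less_le_trans[OF _ Cg_le]) (use Cg_pos in simp)
  have main: "(\<forall>k\<le>K. \<forall>x\<in>{-r..r}. \<bar>U M p k x\<bar> \<le> C * sqrt (weighted_inner \<nu> p p) * real n powr - real k) \<and>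
    (\<forall>x\<in>{-1..1}. \<bar>U M p K x\<bar> \<le> C * sqrt (weighted_inner \<nu> p p) * real n powr - real K)"
    if n: "n \<ge> 1" and M: "\<forall>k\<le>K. deriv_eigenvalue \<nu> M k \<ge> (real n)\<^sup>2 / 2" and ode: "gegenbauer_ode \<nu> M p"
    for n M p
  proof -
    have M_pos: "deriv_eigenvalue \<nu> M k > 0" if "k \<le> K" for k
      by (rule less_le_trans[OF _ M[rule_format, OF that]]) (use n in simp)
    have H: "weighted_inner \<nu> p p \<ge> 0" using \<nu> by (rule weighted_inner_nonneg)
    have U_le: "\<bar>U M p k x\<bar> \<le> C * sqrt (weighted_inner \<nu> p p) * real n powr - real k"
      if k: "k \<le> K" and D: "D > 0" "D * sqrt 2 ^ k \<le> C"
        and w: "\<bar>weight (\<nu> + real k) x * poly ((pderiv ^^ k) p) x\<bar>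
          \<le> D * sqrt (weighted_inner (\<nu> + real k) ((pderiv ^^ k) p) ((pderiv ^^ k) p))" for k x D
    proof -
      \<comment> \<open>The k-th derivative has norm sqrt P times that of p, and \<open>U\<close>
        divides by P. What remains is 1 / sqrt P, at most (sqrt 2 / n)^k, which explains the powers
        of sqrt 2 in \<open>C\<close>.\<close>
      define P where "P = (\<Prod>j<k. deriv_eigenvalue \<nu> M j)"
      have "(\<Prod>j<k. (real n)\<^sup>2 / 2) \<le> P"
        unfolding P_def using M k by (intro prod_mono) auto
      then have "((real n)\<^sup>2 / 2) ^ k \<le> P" by simp
      moreover have "((real n / sqrt 2) ^ k)\<^sup>2 = ((real n)\<^sup>2 / 2) ^ k"
      proof -
        have "((real n / sqrt 2) ^ k)\<^sup>2 = ((real n / sqrt 2)\<^sup>2) ^ k"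
          by (simp only: power_mult[symmetric] mult.commute[of k])
        then show ?thesis by (simp add: power_divide)
      qed
      ultimately have P: "(real n / sqrt 2) ^ k \<le> sqrt P"
        by (intro real_le_rsqrt) simp
      have np: "(real n / sqrt 2) ^ k > 0" using n by simp
      then have P_pos: "sqrt P > 0" using P by linarith
      have "\<bar>U M p k x\<bar> = \<bar>weight (\<nu> + real k) x * poly ((pderiv ^^ k) p) x\<bar> / P"
        using P_pos by (simp add: U_def P_def abs_mult)
      also have "\<dots> \<le> D * sqrt (P * weighted_inner \<nu> p p) / P"
        using w P_pos unfolding weighted_inner_higher_pderiv[OF \<nu> ode] P_def[symmetric]
        by (intro divide_right_mono) auto
      also have "\<dots> = D * sqrt (weighted_inner \<nu> p p) * (1 / sqrt P)"
        using P_pos real_div_sqrt[of P] by (simp add: real_sqrt_mult field_simps)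
      also have "\<dots> \<le> D * sqrt (weighted_inner \<nu> p p) * (1 / (real n / sqrt 2) ^ k)"
        using P np D H by (intro mult_left_mono frac_le) auto
      also have "1 / (real n / sqrt 2) ^ k = sqrt 2 ^ k * real n powr - real k"
        using n by (simp add: power_divide powr_minus_divide powr_realpow)
      also have "D * sqrt (weighted_inner \<nu> p p) * (sqrt 2 ^ k * real n powr - real k)
          = (D * sqrt 2 ^ k) * (sqrt (weighted_inner \<nu> p p) * real n powr - real k)"
        by (simp add: mult_ac)
      also have "\<dots> \<le> C * (sqrt (weighted_inner \<nu> p p) * real n powr - real k)"
        using D H by (intro mult_right_mono) auto
      finally show ?thesis by (simp add: mult.assoc)
    qed
    have "\<bar>weight (\<nu> + real K) x * poly ((pderiv ^^ K) p) x\<bar>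
          \<le> Cg * sqrt (weighted_inner (\<nu> + real K) ((pderiv ^^ K) p) ((pderiv ^^ K) p))"
      if "x \<in> {-1..1}" for x
      using Cg[OF M_pos gegenbauer_ode_higher_pderiv[OF ode] that] by (simp add: K')
    then show ?thesis
      using U_le[OF _ Ci_pos Ci_le Ci[OF M_pos gegenbauer_ode_higher_pderiv[OF ode]]]
        U_le[OF order_refl Cg_pos Cg_le] by blast
  qed
  show ?thesis using main C_pos by (intro exI[of _ C]) blast
qed

text \<open>The abstract estimate is applied to the normalised derivatives of p, with A a constant
  times the norm of p; this makes the constant uniform in p.\<close>

lemma gegenbauer_ode_half_integral_bound:
  fixes G :: "nat \<Rightarrow> real \<Rightarrow> real" and \<mu> :: nat
  assumes \<nu>: "\<nu> > -1/2" and z: "z \<in> {-1<..<1}" and s: "s > 0" and \<mu>: "\<mu> \<ge> 1"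
    and G: "\<And>j x. x \<in> {z<..<1} \<Longrightarrow> (G j has_real_derivative G (Suc j) x) (at x)"
    and contG: "\<And>j. continuous_on {z..1} (G j)"
  shows "\<exists>C>0. \<forall>\<^sub>F n in sequentially. \<forall>p. gegenbauer_ode \<nu> (real n * (real n + 2 * \<nu>)) p \<longrightarrow>
    \<bar>integral {z..1} (\<lambda>x. weight \<nu> x * poly p x * (\<bar>x - z\<bar> powr s * ln \<bar>x - z\<bar> ^ \<mu> * G 0 x))\<bar>
      \<le> C * sqrt (weighted_inner \<nu> p p) * (ln (real n) ^ \<mu> * real n powr (-1 - s))"
proof -
  define K where "K = nat \<lceil>s\<rceil> + 2"
  have K: "K \<ge> 2" "real K > s + 1" unfolding K_def using s by (auto, linarith)
  \<comment> \<open>The midpoint between |z| and 1, so that [z, r] lies in the compact interval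
    [-r, r] where the interior bounds hold.\<close>
  define r where "r = (1 + \<bar>z\<bar>) / 2"
  have "z \<le> \<bar>z\<bar>" "-z \<le> \<bar>z\<bar>" "\<bar>z\<bar> < 1" using z by auto
  then have r: "z < r" "r < 1" "-r \<le> z" unfolding r_def by (simp_all add: field_simps)
  let ?f = "\<lambda>x. \<bar>x - z\<bar> powr s * ln \<bar>x - z\<bar> ^ \<mu> * G 0 x"
  let ?g = "\<lambda>x. (x - z) powr s * ln (x - z) ^ \<mu> * G 0 x"
  define U where "U M p k x =
      weight (\<nu> + real k) x * poly ((pderiv ^^ k) p) x / (\<Prod>j<k. deriv_eigenvalue \<nu> M j)" for M p k x
  obtain C1 where C1: "C1 > 0" "\<And>n M p. n \<ge> 1 \<Longrightarrow> (\<forall>k\<le>K. deriv_eigenvalue \<nu> M k \<ge> (real n)\<^sup>2 / 2) \<Longrightarrow>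
    gegenbauer_ode \<nu> M p \<Longrightarrow>
    (\<forall>k\<le>K. \<forall>x\<in>{-r..r}. \<bar>U M p k x\<bar> \<le> C1 * sqrt (weighted_inner \<nu> p p) * real n powr - real k) \<and>
    (\<forall>x\<in>{-1..1}. \<bar>U M p K x\<bar> \<le> C1 * sqrt (weighted_inner \<nu> p p) * real n powr - real K)"
    using normalised_pderiv_bounds[OF \<nu> r(2) K(1)] unfolding U_def by blast
  obtain C2 where C2: "C2 > 0" and ev: "\<forall>\<^sub>F n in sequentially. \<forall>U A. A \<ge> 0 \<longrightarrow>
    (\<forall>k<K. \<forall>x\<in>{-1<..<1}. (U (Suc k) has_real_derivative - U k x) (at x)) \<longrightarrow>
    (\<forall>k<K. continuous_on {-1..1} (U (Suc k)) \<and> U (Suc k) 1 = 0) \<longrightarrow>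
    (\<forall>k\<le>K. \<forall>x\<in>{z..r}. \<bar>U k x\<bar> \<le> A * real n powr - real k) \<longrightarrow>
    (\<forall>x\<in>{-1..1}. \<bar>U K x\<bar> \<le> A * real n powr - real K) \<longrightarrow>
    (\<lambda>x. U 0 x * ?g x) integrable_on {z..1} \<longrightarrow>
    \<bar>integral {z..1} (\<lambda>x. U 0 x * ?g x)\<bar> \<le> C2 * A * (ln (real n) ^ \<mu> * real n powr (-1 - s))"
    using powr_log_power_mult_integral_bound[of z r s \<mu> K G, OF _ r(1,2) s \<mu> K(2) G contG] z by auto
  have "\<forall>\<^sub>F n in sequentially. \<forall>p. gegenbauer_ode \<nu> (real n * (real n + 2 * \<nu>)) p \<longrightarrow>
    \<bar>integral {z..1} (\<lambda>x. weight \<nu> x * poly p x * ?f x)\<bar>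
      \<le> C2 * C1 * sqrt (weighted_inner \<nu> p p) * (ln (real n) ^ \<mu> * real n powr (-1 - s))"
    using ev eventually_deriv_eigenvalue_ge[of K \<nu>]
  proof eventually_elim
    case (elim n)
    show ?case
    proof (intro allI impI)
      fix p assume ode: "gegenbauer_ode \<nu> (real n * (real n + 2 * \<nu>)) p"
      define M where "M = real n * (real n + 2 * \<nu>)"
      define A where "A = C1 * sqrt (weighted_inner \<nu> p p)"
      have n: "n \<ge> 1" and eig: "\<forall>k\<le>K. deriv_eigenvalue \<nu> M k \<ge> (real n)\<^sup>2 / 2"
        using elim by (auto simp: M_def)
      have A: "A \<ge> 0" using C1 weighted_inner_nonneg[OF \<nu>] by (simp add: A_def)
      note bounds = C1(2)[OF n eig ode[folded M_def], folded A_def]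
      have deriv: "(U M p (Suc k) has_real_derivative - U M p k x) (at x)"
        if "k < K" "x \<in> {-1<..<1}" for k x
      proof -
        have "(real n)\<^sup>2 / 2 > 0" using n by simp
        then have "deriv_eigenvalue \<nu> M k \<noteq> 0"
          using eig[rule_format, of k] that by auto
        then have eq: "- deriv_eigenvalue \<nu> M k * (weight (\<nu> + real k) x * poly ((pderiv ^^ k) p) x)
            / (\<Prod>j<Suc k. deriv_eigenvalue \<nu> M j) = - U M p k x"
          by (simp add: U_def)
        have "((\<lambda>x. weight (\<nu> + real k + 1) x * poly (pderiv ((pderiv ^^ k) p)) x
            / (\<Prod>j<Suc k. deriv_eigenvalue \<nu> M j)) has_real_derivative
          - deriv_eigenvalue \<nu> M k * (weight (\<nu> + real k) x * poly ((pderiv ^^ k) p) x)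
            / (\<Prod>j<Suc k. deriv_eigenvalue \<nu> M j)) (at x)"
          by (intro DERIV_cdivide gegenbauer_ode_has_real_derivative that
              gegenbauer_ode_higher_pderiv ode[folded M_def])
        moreover have "U M p (Suc k) = (\<lambda>x. weight (\<nu> + real k + 1) x * poly (pderiv ((pderiv ^^ k) p)) x
            / (\<Prod>j<Suc k. deriv_eigenvalue \<nu> M j))"
          unfolding U_def by (simp add: add_ac)
        ultimately show ?thesis unfolding eq by simp
      qed
      have cont: "continuous_on {-1..1} (U M p (Suc k)) \<and> U M p (Suc k) 1 = 0" for k
      proof
        show "U M p (Suc k) 1 = 0" by (simp add: U_def)
        \<comment> \<open>From the first antiderivative on, the parameter exceeds 1/2 and the weight
          is continuous up to \<plusminus>1, although \<open>weight \<nu>\<close> itself may blow up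
          there.\<close>
        have w: "continuous_on {-1..1} (weight (\<nu> + real (Suc k)))"
          using \<nu> by (intro weight_continuous_on_closed) simp
        show "continuous_on {-1..1} (U M p (Suc k))"
          unfolding U_def divide_inverse by (intro continuous_intros w)
      qed
      have U0: "U M p 0 x * ?g x = weight \<nu> x * poly p x * ?f x" if "x \<in> {z..1}" for x
        using that by (simp add: U_def)
      have "continuous_on {z..1} (\<lambda>x. poly p x * ?f x)"
        by (intro continuous_on_subset[OF continuous_on_abs_powr_log_power[OF s \<mu>]]
            continuous_on_mult contG continuous_on_poly continuous_on_id) simp_all
      then have "(\<lambda>x. weight \<nu> x * (poly p x * ?f x)) integrable_on {z..1}"
        using z by (intro weight_mult_integrable \<nu>) auto
      then have "(\<lambda>x. U M p 0 x * ?g x) integrable_on {z..1}"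
        using U0 by (subst integrable_cong[OF U0]) (simp_all add: mult.assoc)
      then have "\<bar>integral {z..1} (\<lambda>x. U M p 0 x * ?g x)\<bar>
          \<le> C2 * A * (ln (real n) ^ \<mu> * real n powr (-1 - s))"
        using elim(1)[rule_format, of A "U M p"] A deriv cont bounds r(3) by auto
      moreover have "integral {z..1} (\<lambda>x. U M p 0 x * ?g x)
          = integral {z..1} (\<lambda>x. weight \<nu> x * poly p x * ?f x)"
        by (rule integral_cong[OF U0])
      ultimately show "\<bar>integral {z..1} (\<lambda>x. weight \<nu> x * poly p x * ?f x)\<bar>
        \<le> C2 * C1 * sqrt (weighted_inner \<nu> p p) * (ln (real n) ^ \<mu> * real n powr (-1 - s))"
        by (simp add: A_def mult.assoc)
    qed
  qed
  then show ?thesis using C1 C2 by (intro exI[of _ "C2 * C1"]) auto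
qed

lemma weighted_inner_reflect:
  "weighted_inner \<nu> (pcompose p [:0, -1:]) (pcompose p [:0, -1:]) = weighted_inner \<nu> p p"
  using Henstock_Kurzweil_Integration.integral_reflect_real[of 1 "-1" "\<lambda>x. weight \<nu> x * (poly p x * poly p x)"]
  by (simp add: weighted_inner_def poly_reflect)

text \<open>Split at z and reflect the left half: p(-x) solves the same equation with the same norm,
  and the singularity moves to -z.\<close>

lemma gegenbauer_ode_integral_bound:
  fixes f g :: "real \<Rightarrow> real" and \<mu> :: nat
  assumes \<nu>: "\<nu> > -1/2" and z: "z \<in> {-1<..<1}" and s: "s > 0" and \<mu>: "\<mu> \<ge> 1"
    and g: "smooth_on_set {-1..1} g"
    and f: "\<And>x. x \<in> {-1..1} \<Longrightarrow> f x = \<bar>x - z\<bar> powr s * ln \<bar>x - z\<bar> ^ \<mu> * g x"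
  shows "\<exists>C>0. \<forall>\<^sub>F n in sequentially. \<forall>p. gegenbauer_ode \<nu> (real n * (real n + 2 * \<nu>)) p \<longrightarrow>
    \<bar>integral {-1..1} (\<lambda>x. weight \<nu> x * poly p x * f x)\<bar>
      \<le> C * sqrt (weighted_inner \<nu> p p) * (ln (real n) ^ \<mu> * real n powr (-1 - s))"
proof -
  obtain G :: "nat \<Rightarrow> real \<Rightarrow> real" where G0: "\<And>x. x \<in> {-1..1} \<Longrightarrow> G 0 x = g x"
    and G_within: "\<And>k x. x \<in> {-1..1} \<Longrightarrow> (G k has_real_derivative G (Suc k) x) (at x within {-1..1})"
    using g unfolding smooth_on_set_def by blast
  have G: "(G k has_real_derivative G (Suc k) x) (at x)" if "x \<in> {-1<..<1}" for k x
    using G_within[of x k] at_within_interior[of x "{-1..1}"] that by simp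
  have contG: "continuous_on {-1..1} (G k)" for k
    using G_within by (rule DERIV_continuous_on)
  \<comment> \<open>The sign (-1)^k makes these the successive derivatives of g(-x).\<close>
  define G' where "G' = (\<lambda>k x. (-1) ^ k * G k (- x))"
  have G': "(G' k has_real_derivative G' (Suc k) x) (at x)" if "x \<in> {-1<..<1}" for k x
  proof -
    have "((\<lambda>x. G k (- x)) has_real_derivative - G (Suc k) (- x)) (at x)"
      using G[of "-x" k] that by (simp add: DERIV_mirror)
    from DERIV_cmult[OF this, of "(-1) ^ k"] show ?thesis by (simp add: G'_def)
  qed
  have contG': "continuous_on {-1..1} (G' k)" for k
    unfolding G'_def by (intro continuous_intros continuous_on_compose2[OF contG]) auto
  let ?L = "\<lambda>n::nat. ln (real n) ^ \<mu> * real n powr (-1 - s)"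
  obtain C1 where C1: "C1 > 0" and ev1:
    "\<forall>\<^sub>F n in sequentially. \<forall>p. gegenbauer_ode \<nu> (real n * (real n + 2 * \<nu>)) p \<longrightarrow>
    \<bar>integral {z..1} (\<lambda>x. weight \<nu> x * poly p x * (\<bar>x - z\<bar> powr s * ln \<bar>x - z\<bar> ^ \<mu> * G 0 x))\<bar>
      \<le> C1 * sqrt (weighted_inner \<nu> p p) * ?L n"
    using gegenbauer_ode_half_integral_bound[OF \<nu> z s \<mu>, of G] G z continuous_on_subset[OF contG]
    by auto
  obtain C2 where C2: "C2 > 0" and ev2:
    "\<forall>\<^sub>F n in sequentially. \<forall>p. gegenbauer_ode \<nu> (real n * (real n + 2 * \<nu>)) p \<longrightarrow>
    \<bar>integral {-z..1} (\<lambda>x. weight \<nu> x * poly p x * (\<bar>x - - z\<bar> powr s * ln \<bar>x - - z\<bar> ^ \<mu> * G' 0 x))\<bar>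
      \<le> C2 * sqrt (weighted_inner \<nu> p p) * ?L n"
    using gegenbauer_ode_half_integral_bound[OF \<nu> _ s \<mu>, of "-z" G'] G' z continuous_on_subset[OF contG']
    by auto
  have "\<forall>\<^sub>F n in sequentially. \<forall>p. gegenbauer_ode \<nu> (real n * (real n + 2 * \<nu>)) p \<longrightarrow>
    \<bar>integral {-1..1} (\<lambda>x. weight \<nu> x * poly p x * f x)\<bar>
      \<le> (C1 + C2) * sqrt (weighted_inner \<nu> p p) * ?L n"
    using ev1 ev2
  proof eventually_elim
    case (elim n)
    show ?case
    proof (intro allI impI)
      fix p assume ode: "gegenbauer_ode \<nu> (real n * (real n + 2 * \<nu>)) p"
      let ?h = "\<lambda>x. weight \<nu> x * poly p x * f x"
      let ?q = "pcompose p [:0, -1:]"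
      have "continuous_on {-1..1} (\<lambda>x. poly p x * (\<bar>x - z\<bar> powr s * ln \<bar>x - z\<bar> ^ \<mu> * G 0 x))"
        by (intro continuous_on_subset[OF continuous_on_abs_powr_log_power[OF s \<mu>]]
            continuous_on_mult contG continuous_on_poly continuous_on_id) simp_all
      from weight_mult_integrable[OF \<nu> order_refl order_refl this]
      have int: "?h integrable_on {-1..1}"
        by (rule integrable_eq) (auto simp: f G0 mult_ac)
      have right: "integral {z..1} ?h
          = integral {z..1} (\<lambda>x. weight \<nu> x * poly p x * (\<bar>x - z\<bar> powr s * ln \<bar>x - z\<bar> ^ \<mu> * G 0 x))"
        using z by (intro integral_cong) (simp add: f G0)
      have "integral {-1..z} ?h = integral {-z..1} (\<lambda>x. ?h (- x))"
        using Henstock_Kurzweil_Integration.integral_reflect_real[of z "-1" ?h] by simp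
      also have "\<dots> = integral {-z..1} (\<lambda>x. weight \<nu> x * poly ?q x *
          (\<bar>x - - z\<bar> powr s * ln \<bar>x - - z\<bar> ^ \<mu> * G' 0 x))"
      proof (rule integral_cong)
        fix x assume "x \<in> {-z..1}"
        moreover have "\<bar>- x - z\<bar> = \<bar>x - - z\<bar>" by simp
        ultimately show "?h (- x) = weight \<nu> x * poly ?q x *
            (\<bar>x - - z\<bar> powr s * ln \<bar>x - - z\<bar> ^ \<mu> * G' 0 x)"
          using z by (simp add: f G0 G'_def poly_reflect add.commute)
      qed
      finally have "\<bar>integral {-1..z} ?h\<bar> \<le> C2 * sqrt (weighted_inner \<nu> p p) * ?L n"
        using elim(2)[rule_format, OF gegenbauer_ode_reflect[OF ode]]
        by (simp only: weighted_inner_reflect)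
      moreover have "\<bar>integral {z..1} ?h\<bar> \<le> C1 * sqrt (weighted_inner \<nu> p p) * ?L n"
        using elim(1) ode unfolding right by blast
      moreover have "integral {-1..1} ?h = integral {-1..z} ?h + integral {z..1} ?h"
        using Henstock_Kurzweil_Integration.integral_combine[OF _ _ int, of z] z by simp
      ultimately have "\<bar>integral {-1..1} ?h\<bar> \<le> C2 * sqrt (weighted_inner \<nu> p p) * ?L n
          + C1 * sqrt (weighted_inner \<nu> p p) * ?L n"
        by linarith
      then show "\<bar>integral {-1..1} ?h\<bar> \<le> (C1 + C2) * sqrt (weighted_inner \<nu> p p) * ?L n"
        by (simp add: algebra_simps)
    qed
  qed
  then show ?thesis using C1 C2 by (intro exI[of _ "C1 + C2"]) auto
qed

subsection \<open>Chebyshev and Gegenbauer polynomials\<close>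

text \<open>Differentiate T_n(cos t) = cos(nt) twice. The eigenvalue n^2 is written in the form n(n
  + 2\<nu>) with \<nu> = 0 to match the general estimate.\<close>

lemma chebyshev_T_ode: "gegenbauer_ode 0 (real n * (real n + 2 * 0)) (chebyshev_T n)"
proof (rule gegenbauer_odeI)
  fix x :: real assume "x \<in> {-1<..<1}"
  define t where "t = arccos x"
  have x: "x = cos t" and t: "sin t > 0"
    using \<open>x \<in> {-1<..<1}\<close> arccos_lt_bounded[of x] by (auto simp: t_def intro!: sin_gt_zero)
  let ?T = "chebyshev_T n" and ?T' = "pderiv (chebyshev_T n)"
  have T: "(\<lambda>t. poly ?T (cos t)) = (\<lambda>t. cos (real n * t))"
    by (simp add: poly_chebyshev_T_cos)
  have D1: "((\<lambda>t. poly ?T (cos t)) has_real_derivative poly ?T' (cos u) * (- sin u)) (at u)" for u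
    by (rule DERIV_chain2[OF poly_DERIV]) (rule DERIV_cos)
  have D2: "((\<lambda>t. cos (real n * t)) has_real_derivative - real n * sin (real n * u)) (at u)" for u
    by (auto intro!: derivative_eq_intros)
  \<comment> \<open>The first derivative of the identity, valid for every u and hence open to a
    second differentiation.\<close>
  have T': "sin u * poly ?T' (cos u) = real n * sin (real n * u)" for u
    using DERIV_unique[OF D1[unfolded T] D2, of u] by (simp add: mult.commute)
  have "((\<lambda>u. sin u * poly ?T' (cos u)) has_real_derivative
      cos t * poly ?T' (cos t) + poly (pderiv ?T') (cos t) * (- sin t) * sin t) (at t)"
    by (intro DERIV_mult DERIV_sin DERIV_chain2[OF poly_DERIV] DERIV_cos)
  moreover have "((\<lambda>u. real n * sin (real n * u)) has_real_derivative
      real n * (real n * cos (real n * t))) (at t)"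
    by (auto intro!: derivative_eq_intros)
  ultimately have "cos t * poly ?T' (cos t) + poly (pderiv ?T') (cos t) * (- sin t) * sin t
      = real n * (real n * cos (real n * t))"
    unfolding T' by (rule DERIV_unique)
  moreover have sq: "1 - x\<^sup>2 = sin t * sin t"
    unfolding x using sin_cos_squared_add[of t] by (simp add: power2_eq_square)
  ultimately show "(1 - x\<^sup>2) * poly (pderiv (pderiv ?T)) x =
      (2 * 0 + 1) * x * poly (pderiv ?T) x - real n * (real n + 2 * 0) * poly ?T x"
    unfolding sq by (simp add: x poly_chebyshev_T_cos algebra_simps)
qed

section \<open>Uniform upper bound for the Chebyshev norms\<close>

lemma abs_poly_chebyshev_T_le:
  assumes "x \<in> {-1..1}"
  shows "\<bar>poly (chebyshev_T n) x\<bar> \<le> 1"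
proof -
  have "x = cos (arccos x)" using assms by (simp add: cos_arccos)
  then show ?thesis by (metis poly_chebyshev_T_cos abs_cos_le_one)
qed

lemma weighted_inner_chebyshev_T_le:
  "\<exists>c>0. \<forall>n. weighted_inner 0 (chebyshev_T n) (chebyshev_T n) \<le> c"
proof -
  obtain c where c: "c > 0" "(weight 0 has_integral c) {-1..1}"
    using weight_has_integral[of 0] by auto
  have "weighted_inner 0 (chebyshev_T n) (chebyshev_T n) \<le> c" for n
  proof -
    have "weight 0 x * (poly (chebyshev_T n) x * poly (chebyshev_T n) x) \<le> weight 0 x"
      if "x \<in> {-1..1}" for x
    proof -
      have "poly (chebyshev_T n) x * poly (chebyshev_T n) x \<le> 1"
        using abs_poly_chebyshev_T_le[OF that, of n] by (simp add: abs_square_le_1 flip: power2_eq_square)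
      from mult_left_mono[OF this weight_nonneg] show ?thesis by simp
    qed
    then show ?thesis
      unfolding weighted_inner_def using c(2) weighted_inner_integrable[of 0]
      by (intro has_integral_le[OF integrable_integral c(2)]) auto
  qed
  with c(1) show ?thesis by blast
qed

text \<open>The two first-order relations
  \<open>C'(n) = x C'(n+1) - (n+1) C(n+1)\<close> and \<open>C'(n+1) = x C'(n) + (n + 2 lam) C(n)\<close>
  are inductive jointly with the recurrence, and eliminating \<open>C(n)\<close> gives the differential equation.\<close>

lemma gegenbauer_pderiv_relations:
  "poly (pderiv (gegenbauer lam n)) x
      = x * poly (pderiv (gegenbauer lam (Suc n))) x - (real n + 1) * poly (gegenbauer lam (Suc n)) x \<and>
   poly (pderiv (gegenbauer lam (Suc n))) x
      = x * poly (pderiv (gegenbauer lam n)) x + (real n + 2 * lam) * poly (gegenbauer lam n) x"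
proof (induction n)
  case 0
  show ?case by (simp add: pderiv_pCons)
next
  case (Suc n)
  define c0 c1 c2 d0 d1 d2 where
    "c0 = poly (gegenbauer lam n) x" and "c1 = poly (gegenbauer lam (Suc n)) x" and
    "c2 = poly (gegenbauer lam (Suc (Suc n))) x" and
    "d0 = poly (pderiv (gegenbauer lam n)) x" and "d1 = poly (pderiv (gegenbauer lam (Suc n))) x" and
    "d2 = poly (pderiv (gegenbauer lam (Suc (Suc n)))) x"
  note defs = this
  define m where "m = real n + 2"
  have m: "m \<noteq> 0" and m1: "m - 1 = real n + 1" and m2: "m - 2 = real n" by (simp_all add: m_def)
  have IH: "d0 = x * d1 - (m - 1) * c1" "d1 = x * d0 + (m - 2 + 2 * lam) * c0"
    using Suc unfolding defs[symmetric] m1 m2 by blast+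
  have "c2 = 2 * (m - 1 + lam) / m * (x * c1) - (m - 2 + 2 * lam) / m * c0"
    by (simp add: defs m_def)
  then have c2: "m * c2 = 2 * (m - 1 + lam) * (x * c1) - (m - 2 + 2 * lam) * c0"
    using m by (simp add: right_diff_distrib)
  have "pderiv (gegenbauer lam (Suc (Suc n)))
      = smult (2 * (real n + 1 + lam) / (real n + 2))
          (gegenbauer lam (Suc n) + [:0, 1:] * pderiv (gegenbauer lam (Suc n)))
        - smult ((real n + 2 * lam) / (real n + 2)) (pderiv (gegenbauer lam n))"
    by (simp only: gegenbauer.simps(3) pderiv_diff pderiv_smult pderiv_mult)
       (simp add: pderiv_pCons add.commute)
  then have "d2 = 2 * (m - 1 + lam) / m * (c1 + x * d1) - (m - 2 + 2 * lam) / m * d0"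
    unfolding m1 m2 by (simp add: defs m_def del: gegenbauer.simps)
  then have "m * d2 = 2 * (m - 1 + lam) * (c1 + x * d1) - (m - 2 + 2 * lam) * d0"
    using m by (simp add: right_diff_distrib)
  also have "\<dots> = m * (x * d1 + (m - 1 + 2 * lam) * c1)"
    unfolding IH(1) by (simp add: algebra_simps)
  finally have d2: "d2 = x * d1 + (m - 1 + 2 * lam) * c1" using m by simp
  \<comment> \<open>Eliminating \<open>d0\<close> between the two induction hypotheses; inserting
    the new \<open>d2\<close> and the recurrence for \<open>c2\<close> turns this into the first
    relation for the next index.\<close>
  have "d1 = x * (x * d1 - (m - 1) * c1) + (m - 2 + 2 * lam) * c0"
    using IH by simp
  then have "d1 = x * d2 - m * c2"
    unfolding d2 c2 by (simp add: algebra_simps)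
  with d2 show ?case by (simp add: defs m_def algebra_simps)
qed

lemma gegenbauer_has_gegenbauer_ode:
  "gegenbauer_ode lam (real n * (real n + 2 * lam)) (gegenbauer lam n)"
proof (cases n)
  case 0
  then show ?thesis by (simp add: gegenbauer_ode_def)
next
  case (Suc m)
  let ?p = "gegenbauer lam m" and ?q = "gegenbauer lam (Suc m)"
  \<comment> \<open>The relations are restated as polynomial identities so that they can be
    differentiated again.\<close>
  have "pderiv ?p = [:0, 1:] * pderiv ?q - smult (real m + 1) ?q"
    "pderiv ?q = [:0, 1:] * pderiv ?p + smult (real m + 2 * lam) ?p"
    unfolding poly_eq_poly_eq_iff[symmetric] fun_eq_iff
    using gegenbauer_pderiv_relations[of lam m] by (simp_all add: algebra_simps)
  note rel = this
  show ?thesis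
  proof (rule gegenbauer_odeI)
    fix x :: real
    define c d e a b where "c = poly ?q x" and "d = poly (pderiv ?q) x"
      and "e = poly (pderiv (pderiv ?q)) x" and "a = poly (pderiv ?p) x"
      and "b = poly (pderiv (pderiv ?p)) x"
    have a: "a = x * d - (real m + 1) * c"
      using arg_cong[OF rel(1), of "\<lambda>p. poly p x"] by (simp add: a_def d_def c_def)
    have b: "b = d + x * e - (real m + 1) * d"
      using arg_cong[OF rel(1), of "\<lambda>p. poly (pderiv p) x"]
      by (simp add: b_def d_def e_def pderiv_diff pderiv_mult pderiv_smult pderiv_pCons)
    have "e = a + x * b + (real m + 2 * lam) * a"
      using arg_cong[OF rel(2), of "\<lambda>p. poly (pderiv p) x"]
      by (simp add: a_def b_def e_def pderiv_add pderiv_mult pderiv_smult pderiv_pCons)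
    then have "e = x * (d + x * e - (real m + 1) * d)
        + (real m + 1 + 2 * lam) * (x * d - (real m + 1) * c)"
      unfolding a b by (simp add: algebra_simps)
    then show "(1 - x\<^sup>2) * poly (pderiv (pderiv (gegenbauer lam n))) x =
        (2 * lam + 1) * x * poly (pderiv (gegenbauer lam n)) x
        - real n * (real n + 2 * lam) * poly (gegenbauer lam n) x"
      by (simp add: Suc c_def d_def e_def power2_eq_square algebra_simps)
  qed
qed

section \<open>Orthogonality and the size of the Gegenbauer norms\<close>

lemma gegenbauer_orthogonal:
  assumes "lam > -1/2" "m < n"
  shows "weighted_inner lam (gegenbauer lam m) (gegenbauer lam n) = 0"
proof -
  let ?p = "gegenbauer lam m" and ?q = "gegenbauer lam n"
  have "real m * (real m + 2 * lam) * weighted_inner lam ?p ?q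
      = weighted_inner (lam + 1) (pderiv ?p) (pderiv ?q)"
    by (rule weighted_inner_pderiv[symmetric] assms gegenbauer_has_gegenbauer_ode)+
  also have "\<dots> = weighted_inner (lam + 1) (pderiv ?q) (pderiv ?p)"
    by (rule weighted_inner_commute)
  also have "\<dots> = real n * (real n + 2 * lam) * weighted_inner lam ?q ?p"
    by (rule weighted_inner_pderiv assms gegenbauer_has_gegenbauer_ode)+
  also have "weighted_inner lam ?q ?p = weighted_inner lam ?p ?q"
    by (rule weighted_inner_commute)
  \<comment> \<open>Green's identity read in both orders: the difference of the eigenvalues factors
    as (n - m)(n + m + 2 lam), which is positive because n + m \<ge> 1 and lam > -1/2.\<close>
  finally have "(real n - real m) * (real n + real m + 2 * lam) * weighted_inner lam ?p ?q = 0"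
    by (simp add: algebra_simps)
  moreover have "real n - real m > 0" "real n + real m + 2 * lam > 0"
    using assms by auto
  ultimately show ?thesis by simp
qed

text \<open>Both norms are tied to X, the inner product of x C(n) with C(n+1): pair the recurrence
  for C(n+2) with C(n) and the one for C(n+1) with C(n+1). Orthogonality removes the other terms,
  and X is then eliminated.\<close>

lemma gegenbauer_norm_Suc:
  assumes lam: "lam > -1/2"
  defines "h \<equiv> \<lambda>n. weighted_inner lam (gegenbauer lam n) (gegenbauer lam n)"
  shows "(real n + 1) * (real n + 1 + lam) * h (Suc n) = (real n + lam) * (real n + 2 * lam) * h n"
proof -
  let ?C = "gegenbauer lam"
  define X where "X = weighted_inner lam ([:0, 1:] * ?C n) (?C (Suc n))"
  have "weighted_inner lam (?C (Suc (Suc n))) (?C n) = 0"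
    using gegenbauer_orthogonal[OF lam, of n "Suc (Suc n)"] by (simp add: weighted_inner_commute)
  moreover have "weighted_inner lam ([:0, 1:] * ?C (Suc n)) (?C n) = X"
    unfolding X_def by (subst weighted_inner_mult_left) (rule weighted_inner_commute)
  ultimately have "2 * (real n + 1 + lam) / (real n + 2) * X = (real n + 2 * lam) / (real n + 2) * h n"
    by (simp only: gegenbauer.simps(3) weighted_inner_diff[OF lam] weighted_inner_smult h_def)
  then have 1: "2 * (real n + 1 + lam) * X = (real n + 2 * lam) * h n"
    by (simp add: field_simps)
  have 2: "(real n + 1) * h (Suc n) = 2 * (real n + lam) * X"
  proof (cases n)
    case 0
    have "?C (Suc n) = smult (2 * lam) ([:0, 1:] * ?C n)" by (simp add: 0)
    then have "h (Suc n) = 2 * lam * X"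
      unfolding h_def X_def by (metis weighted_inner_smult)
    then show ?thesis by (simp add: 0)
  next
    case (Suc m)
    have "h (Suc n) = 2 * (real m + 1 + lam) / (real m + 2) * X
        - (real m + 2 * lam) / (real m + 2) * weighted_inner lam (?C m) (?C (Suc n))"
      unfolding h_def X_def weighted_inner_smult[symmetric] weighted_inner_diff[OF lam, symmetric] Suc
      by simp
    also have "weighted_inner lam (?C m) (?C (Suc n)) = 0"
      by (rule gegenbauer_orthogonal[OF lam]) (simp add: Suc)
    finally show ?thesis by (simp add: Suc field_simps)
  qed
  have "(real n + 1) * (real n + 1 + lam) * h (Suc n) = (real n + 1 + lam) * (2 * (real n + lam) * X)"
    unfolding 2[symmetric] by simp
  also have "\<dots> = (real n + lam) * (2 * (real n + 1 + lam) * X)" by (simp add: algebra_simps)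
  finally show ?thesis unfolding 1 by simp
qed

text \<open>The recurrence multiplies n! (n + lam) h(n) by n + 2 lam at each step. Starting from
  h(1) makes the base 2 lam + 1 of the product positive, also for negative lam.\<close>

lemma gegenbauer_norm_pochhammer:
  assumes lam: "lam > -1/2"
  defines "h \<equiv> \<lambda>n. weighted_inner lam (gegenbauer lam n) (gegenbauer lam n)"
  shows "fact (Suc n) * (real (Suc n) + lam) * h (Suc n)
    = (1 + lam) * h 1 * pochhammer (2 * lam + 1) n"
proof (induction n)
  case (Suc n)
  let ?k = "real (Suc n)"
  have "fact (Suc (Suc n)) * (real (Suc (Suc n)) + lam) * h (Suc (Suc n))
      = fact (Suc n) * ((?k + 1) * (?k + 1 + lam) * h (Suc (Suc n)))"
    by (simp add: algebra_simps)
  also have "\<dots> = fact (Suc n) * ((?k + lam) * (?k + 2 * lam) * h (Suc n))"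
    unfolding h_def gegenbauer_norm_Suc[OF lam] ..
  also have "\<dots> = (?k + 2 * lam) * (fact (Suc n) * (?k + lam) * h (Suc n))"
    by (simp only: mult_ac)
  also have "\<dots> = (1 + lam) * h 1 * pochhammer (2 * lam + 1) (Suc n)"
    unfolding Suc pochhammer_Suc by (simp add: algebra_simps)
  finally show ?case .
qed simp

text \<open>The norm recurrence at n = 0 expresses h(1) as a positive multiple of lam^2. This is
  where \<open>lam \<noteq> 0\<close> enters: C(1) = 2 lam x vanishes for lam = 0.\<close>

lemma weighted_inner_gegenbauer_1_pos:
  assumes "lam > -1/2" "lam \<noteq> 0"
  shows "weighted_inner lam (gegenbauer lam 1) (gegenbauer lam 1) > 0"
proof -
  obtain c where c: "c > 0" "(weight lam has_integral c) {-1..1}"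
    using weight_has_integral[OF assms(1)] by auto
  have "weighted_inner lam (gegenbauer lam 0) (gegenbauer lam 0) = c"
    using c(2) by (simp add: weighted_inner_def integral_unique)
  then have "(1 + lam) * weighted_inner lam (gegenbauer lam 1) (gegenbauer lam 1) = 2 * lam\<^sup>2 * c"
    using gegenbauer_norm_Suc[OF assms(1), of 0] by (simp add: power2_eq_square)
  moreover have "2 * lam\<^sup>2 * c > 0" "1 + lam > 0" using assms c(1) by auto
  ultimately show ?thesis by (metis zero_less_mult_pos)
qed

text \<open>Euler's limit: n! n^z divided by the Pochhammer symbol of length n + 1 tends to
  Gamma(z), so it is eventually below 2 Gamma(z). The last factor z + n is at most (1 + z)
  n.\<close>

lemma eventually_pochhammer_ge:
  fixes z :: real
  assumes "z > 0"
  shows "\<exists>c>0. \<forall>\<^sub>F n in sequentially. pochhammer z n \<ge> c * fact n * real n powr (z - 1)"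
proof -
  have "Gamma z < 2 * Gamma z" using Gamma_real_pos[OF assms] by simp
  then have ev: "\<forall>\<^sub>F n in sequentially. Gamma_series z n < 2 * Gamma z"
    by (rule order_tendstoD(2)[OF Gamma_series_LIMSEQ])
  define c where "c = 1 / (2 * Gamma z * (1 + z))"
  have c: "c > 0" using assms Gamma_real_pos[OF assms] by (simp add: c_def)
  have "\<forall>\<^sub>F n in sequentially. pochhammer z n \<ge> c * fact n * real n powr (z - 1)"
    using ev eventually_ge_at_top[of 1]
  proof eventually_elim
    case (elim n)
    have n: "real n \<ge> 1" using elim by simp
    have P: "pochhammer z n > 0" using assms by (rule pochhammer_pos)
    have "Gamma_series z n = fact n * real n powr z / (pochhammer z n * (z + real n))"
      using n by (simp add: Gamma_series_def powr_def pochhammer_Suc)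
    with elim(1) have "fact n * real n powr z < 2 * Gamma z * (pochhammer z n * (z + real n))"
      using P n assms by (simp add: divide_less_eq)
    also have "\<dots> \<le> 2 * Gamma z * (pochhammer z n * ((1 + z) * real n))"
      using P n assms Gamma_real_pos[OF assms] mult_left_mono[of 1 "real n" z]
      by (intro mult_left_mono) (auto simp: algebra_simps)
    also have "fact n * real n powr z = real n * (fact n * real n powr (z - 1))"
      using n by (simp add: powr_diff)
    finally have "real n * (fact n * real n powr (z - 1))
        < real n * (2 * Gamma z * (1 + z) * pochhammer z n)"
      by (simp add: mult_ac)
    then have "fact n * real n powr (z - 1) < 2 * Gamma z * (1 + z) * pochhammer z n"
      using n by simp
    moreover have "2 * Gamma z * (1 + z) > 0" using assms Gamma_real_pos[OF assms] by simp
    ultimately have "fact n * real n powr (z - 1) / (2 * Gamma z * (1 + z)) < pochhammer z n"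
      by (simp only: pos_divide_less_eq mult_ac)
    then show ?case by (simp add: c_def)
  qed
  with c show ?thesis by blast
qed

lemma eventually_gegenbauer_norm_ge:
  assumes lam: "lam > -1/2" "lam \<noteq> 0"
  shows "\<exists>c>0. \<forall>\<^sub>F n in sequentially.
    weighted_inner lam (gegenbauer lam n) (gegenbauer lam n) \<ge> c * real n powr (2 * lam - 2)"
proof -
  define h where "h n = weighted_inner lam (gegenbauer lam n) (gegenbauer lam n)" for n
  have h1: "h 1 > 0" unfolding h_def using lam by (rule weighted_inner_gegenbauer_1_pos)
  obtain c where c: "c > 0"
    "\<forall>\<^sub>F n in sequentially. pochhammer (2 * lam + 1) n \<ge> c * fact n * real n powr (2 * lam)"
    using eventually_pochhammer_ge[of "2 * lam + 1"] lam(1) by auto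
  define c' where "c' = (1 + lam) * h 1 * c"
  have c': "c' > 0" using lam h1 c(1) by (simp add: c'_def)
  \<comment> \<open>The left side is asymptotic to n^(2 lam - 2), so the factor 1/2 leaves room for
    replacing n by n + 1.\<close>
  have "\<forall>\<^sub>F n in sequentially.
      real n powr (2 * lam) / ((real n + 1) * (real n + 1 + lam)) \<ge> 1/2 * (real n + 1) powr (2 * lam - 2)"
    by real_asymp
  then have "\<forall>\<^sub>F n in sequentially. h (Suc n) \<ge> c' / 2 * real (Suc n) powr (2 * lam - 2)"
    using c(2)
  proof eventually_elim
    case (elim n)
    have pos: "fact (Suc n) * (real (Suc n) + lam) > 0" using lam by simp
    have "fact (Suc n) * (real (Suc n) + lam) * h (Suc n) = (1 + lam) * h 1 * pochhammer (2 * lam + 1) n"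
      unfolding h_def by (rule gegenbauer_norm_pochhammer[OF lam(1)])
    also have "\<dots> \<ge> (1 + lam) * h 1 * (c * fact n * real n powr (2 * lam))"
      using lam h1 elim(2) by (intro mult_left_mono) auto
    finally have "h (Suc n) \<ge>
        (1 + lam) * h 1 * (c * fact n * real n powr (2 * lam)) / (fact (Suc n) * (real (Suc n) + lam))"
      by (subst pos_divide_le_eq[OF pos]) (simp only: mult_ac)
    also have "(1 + lam) * h 1 * (c * fact n * real n powr (2 * lam)) / (fact (Suc n) * (real (Suc n) + lam))
        = c' * (real n powr (2 * lam) / ((real n + 1) * (real n + 1 + lam)))"
      by (simp add: c'_def add_ac)
    also have "\<dots> \<ge> c' * (1/2 * (real n + 1) powr (2 * lam - 2))"
      using elim(1) c' by (intro mult_left_mono) auto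
    finally show ?case by (simp add: add_ac)
  qed
  then have "\<forall>\<^sub>F n in sequentially. h n \<ge> c' / 2 * real n powr (2 * lam - 2)"
    by (subst (asm) eventually_sequentially_Suc)
  then show ?thesis using c' unfolding h_def by (intro exI[of _ "c' / 2"]) auto
qed

section \<open>Decay rates of the Gegenbauer and Chebyshev coefficients\<close>

theorem corollary3:
  fixes z\<^sub>0 s lam :: real and \<mu> :: nat and f g :: "real \<Rightarrow> real"
  assumes "z\<^sub>0 \<in> {-1<..<1}"
    and "s > 0"
    and "\<mu> \<ge> 1"
    and "smooth_on_set {-1..1} g"
    and "\<And>x. x \<in> {-1..1} \<Longrightarrow> f x = \<bar>x - z\<^sub>0\<bar> powr s * ln \<bar>x - z\<^sub>0\<bar> ^ \<mu> * g x"
    and "lam > -1/2" and "lam \<noteq> 0"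
  shows "(\<lambda>n. \<bar>gegenbauer_coeff lam f n\<bar>) \<in> O(\<lambda>n. ln (real n) ^ \<mu> * real n powr (- lam - s))
    \<and> (\<lambda>n. \<bar>chebyshev_coeff f n\<bar>) \<in> O(\<lambda>n. ln (real n) ^ \<mu> * real n powr (-1 - s))"
proof
  define h where "h n = weighted_inner lam (gegenbauer lam n) (gegenbauer lam n)" for n
  obtain C where C: "C > 0" and evC: "\<forall>\<^sub>F n in sequentially. \<forall>p.
    gegenbauer_ode lam (real n * (real n + 2 * lam)) p \<longrightarrow>
    \<bar>integral {-1..1} (\<lambda>x. weight lam x * poly p x * f x)\<bar>
      \<le> C * sqrt (weighted_inner lam p p) * (ln (real n) ^ \<mu> * real n powr (-1 - s))"
    using gegenbauer_ode_integral_bound[OF assms(6,1-5)] by blast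
  obtain c where c: "c > 0" and evc: "\<forall>\<^sub>F n in sequentially. h n \<ge> c * real n powr (2 * lam - 2)"
    using eventually_gegenbauer_norm_ge[OF assms(6,7)] unfolding h_def by blast
  have "\<forall>\<^sub>F n in sequentially. norm \<bar>gegenbauer_coeff lam f n\<bar>
      \<le> C / sqrt c * norm (ln (real n) ^ \<mu> * real n powr (- lam - s))"
    using evC evc eventually_ge_at_top[of 1]
  proof eventually_elim
    case (elim n)
    let ?I = "integral {-1..1} (\<lambda>x. weight lam x * poly (gegenbauer lam n) x * f x)"
    have n: "real n > 0" using elim by simp
    have h: "h n > 0" using elim(2) c n by (intro less_le_trans[OF _ elim(2)]) simp
    have "gegenbauer_norm lam n = h n"
      by (simp add: gegenbauer_norm_def h_def weighted_inner_def weight_def power2_eq_square)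
    moreover have "gegenbauer_coeff lam f n = 1 / gegenbauer_norm lam n * ?I"
      by (simp add: gegenbauer_coeff_def weight_def)
    ultimately have "\<bar>gegenbauer_coeff lam f n\<bar> = \<bar>?I\<bar> / h n"
      using h by (simp add: abs_mult)
    also have "\<dots> \<le> C * sqrt (h n) * (ln (real n) ^ \<mu> * real n powr (-1 - s)) / h n"
      using elim(1) gegenbauer_has_gegenbauer_ode h unfolding h_def
      by (intro divide_right_mono) auto
    \<comment> \<open>The integral bound carries sqrt h and the coefficient divides by h, leaving 1
      / sqrt h. The lower bound on h turns this into n^(1 - lam), and the exponents add up to -lam -
      s.\<close>
    also have "\<dots> = C * (ln (real n) ^ \<mu> * real n powr (-1 - s)) * (1 / sqrt (h n))"
      using h real_div_sqrt[of "h n"] by (simp add: field_simps)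
    also have "\<dots> \<le> C * (ln (real n) ^ \<mu> * real n powr (-1 - s)) * (1 / (sqrt c * real n powr (lam - 1)))"
    proof (intro mult_left_mono divide_left_mono)
      have "sqrt (real n powr (2 * lam - 2)) = real n powr (lam - 1)"
        using n by (simp add: powr_half_sqrt[symmetric] powr_powr algebra_simps)
      then show "sqrt c * real n powr (lam - 1) \<le> sqrt (h n)"
        using real_sqrt_le_mono[OF elim(2)] by (simp add: real_sqrt_mult)
      show "0 \<le> C * (ln (real n) ^ \<mu> * real n powr (-1 - s))"
        using C elim(3) by simp
    qed (use c n h in auto)
    also have "\<dots> = C / sqrt c * (ln (real n) ^ \<mu> * (real n powr (-1 - s) / real n powr (lam - 1)))"
      by simp
    also have "real n powr (-1 - s) / real n powr (lam - 1) = real n powr (- lam - s)"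
      unfolding powr_diff[symmetric] by (rule arg_cong[where f = "(powr) (real n)"]) simp
    finally show ?case using elim(3) by simp
  qed
  then show "(\<lambda>n. \<bar>gegenbauer_coeff lam f n\<bar>) \<in> O(\<lambda>n. ln (real n) ^ \<mu> * real n powr (- lam - s))"
    by (rule bigoI)
next
  obtain C where C: "C > 0" and evC: "\<forall>\<^sub>F n in sequentially. \<forall>p.
    gegenbauer_ode 0 (real n * (real n + 2 * 0)) p \<longrightarrow>
    \<bar>integral {-1..1} (\<lambda>x. weight 0 x * poly p x * f x)\<bar>
      \<le> C * sqrt (weighted_inner 0 p p) * (ln (real n) ^ \<mu> * real n powr (-1 - s))"
    using gegenbauer_ode_integral_bound[OF _ assms(1-5), of 0] by auto
  obtain c where c: "c > 0" "\<And>n. weighted_inner 0 (chebyshev_T n) (chebyshev_T n) \<le> c"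
    using weighted_inner_chebyshev_T_le by blast
  have "\<forall>\<^sub>F n in sequentially. norm \<bar>chebyshev_coeff f n\<bar>
      \<le> 2 / pi * C * sqrt c * norm (ln (real n) ^ \<mu> * real n powr (-1 - s))"
    using evC eventually_ge_at_top[of 1]
  proof eventually_elim
    case (elim n)
    let ?I = "integral {-1..1} (\<lambda>x. weight 0 x * poly (chebyshev_T n) x * f x)"
    \<comment> \<open>At the endpoints both sides are 0, by division by zero on the left and
      \<open>0 powr a = 0\<close> on the right.\<close>
    have "f x * poly (chebyshev_T n) x / sqrt (1 - x\<^sup>2) = weight 0 x * poly (chebyshev_T n) x * f x"
      if "x \<in> {-1..1}" for x
      using one_minus_square_nonneg[OF that] by (simp add: weight_def powr_minus powr_half_sqrt field_simps)
    then have "integral {-1..1} (\<lambda>x. f x * poly (chebyshev_T n) x / sqrt (1 - x\<^sup>2)) = ?I"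
      by (rule integral_cong)
    then have "\<bar>chebyshev_coeff f n\<bar> = 2 / pi * \<bar>?I\<bar>"
      using elim(2) by (simp add: chebyshev_coeff_def abs_mult)
    also have "\<dots> \<le> 2 / pi * (C * sqrt (weighted_inner 0 (chebyshev_T n) (chebyshev_T n))
        * (ln (real n) ^ \<mu> * real n powr (-1 - s)))"
      using elim(1) chebyshev_T_ode by (intro mult_left_mono) auto
    also have "\<dots> \<le> 2 / pi * (C * sqrt c * (ln (real n) ^ \<mu> * real n powr (-1 - s)))"
      using C c elim(2) by (intro mult_left_mono mult_right_mono) auto
    finally show ?case using elim(2) by simp
  qed
  then show "(\<lambda>n. \<bar>chebyshev_coeff f n\<bar>) \<in> O(\<lambda>n. ln (real n) ^ \<mu> * real n powr (-1 - s))"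
    by (rule bigoI)
qed

end
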